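(* Let $C:f=0$ be a reduced curve in $\mathbb{P}^2$ and let $L$ be a line in $\mathbb{P}^2$ which is not an irreducible component of $C$. Assume that the union $C'=C\cup L:f'=0$ is a free curve. Then $C$ is either a free curve or a plus-one generated curve.
   Context: Let $S=\mathbb{C}[x,y,z]$. For a reduced homogeneous polynomial $f\in S$ of degree $d$ defining a plane curve $C:f=0$ (the paper works with reduced curves of degree $d\ge 3$), let $D_0(f)=\{(a,b,c)\in S^3 : af_x+bf_y+cf_z=0\}$ be the graded $S$-module of Jacobian syzygies. If $D_0(f)$ is minimally generated by $m$ homogeneous elements, of degrees $d_1\le d_2\le\dots\le d_m$ (these are independent of the choice of minimal generators), the degrees $(d_1,\dots,d_m)$ are called the exponents of $C$. The curve $C$ is free if $m=2$ (i.e. $D_0(f)$ is a free $S$-module of rank 2), and $C$ is plus-one generated if $m=3$ and $d_1+d_2=d$. *)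

theory Defs
  imports Complex_Main "HOL-Library.Poly_Mapping"
begin

text \<open>Polynomials in S = C[x,y,z]: finitely supported maps from exponent vectors
(nat \<Rightarrow>0 nat, variables x,y,z indexed by 0,1,2) to complex coefficients.
The ring structure (convolution product) is the one of HOL-Library.Poly_Mapping.\<close>

type_synonym mpoly = "(nat \<Rightarrow>\<^sub>0 nat) \<Rightarrow>\<^sub>0 complex"

definition in_S :: "mpoly \<Rightarrow> bool" where
  "in_S p \<longleftrightarrow> (\<forall>t \<in> Poly_Mapping.keys p. Poly_Mapping.keys t \<subseteq> {0, 1, 2})"

definition mon_deg :: "(nat \<Rightarrow>\<^sub>0 nat) \<Rightarrow> nat" where
  "mon_deg t = (\<Sum>i \<in> Poly_Mapping.keys t. Poly_Mapping.lookup t i)"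

text \<open>homogeneous of degree k (the zero polynomial is homogeneous of every degree)\<close>
definition homog :: "nat \<Rightarrow> mpoly \<Rightarrow> bool" where
  "homog k p \<longleftrightarrow> in_S p \<and> (\<forall>t \<in> Poly_Mapping.keys p. mon_deg t = k)"

definition pdiff :: "nat \<Rightarrow> mpoly \<Rightarrow> mpoly" where
  "pdiff i p = (\<Sum>t \<in> Poly_Mapping.keys p.
      Poly_Mapping.single (t - Poly_Mapping.single i 1) (of_nat (Poly_Mapping.lookup t i) * Poly_Mapping.lookup p t))"

definition reduced :: "mpoly \<Rightarrow> bool" where
  "reduced f \<longleftrightarrow> in_S f \<and> f \<noteq> 0 \<and> (\<forall>g. in_S g \<and> g * g dvd f \<longrightarrow> g dvd 1)"

type_synonym triple = "mpoly \<times> mpoly \<times> mpoly"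

definition D0 :: "mpoly \<Rightarrow> triple set" where
  "D0 f = {(a, b, c). in_S a \<and> in_S b \<and> in_S c \<and>
            a * pdiff 0 f + b * pdiff 1 f + c * pdiff 2 f = 0}"

definition homog_triple :: "nat \<Rightarrow> triple \<Rightarrow> bool" where
  "homog_triple k v \<longleftrightarrow> (case v of (a, b, c) \<Rightarrow> homog k a \<and> homog k b \<and> homog k c)"

definition lin_comb :: "mpoly list \<Rightarrow> triple list \<Rightarrow> triple" where
  "lin_comb hs gs =
     ((\<Sum>i < length gs. hs ! i * fst (gs ! i)),
      (\<Sum>i < length gs. hs ! i * fst (snd (gs ! i))),
      (\<Sum>i < length gs. hs ! i * snd (snd (gs ! i))))"

definition hom_gen_system :: "mpoly \<Rightarrow> triple list \<Rightarrow> nat list \<Rightarrow> bool" where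
  "hom_gen_system f gs ds \<longleftrightarrow> length ds = length gs \<and>
     (\<forall>i < length gs. gs ! i \<in> D0 f \<and> homog_triple (ds ! i) (gs ! i)) \<and>
     (\<forall>v \<in> D0 f. \<exists>hs. length hs = length gs \<and> (\<forall>h \<in> set hs. in_S h) \<and> v = lin_comb hs gs)"

definition min_hom_gen_system :: "mpoly \<Rightarrow> triple list \<Rightarrow> nat list \<Rightarrow> bool" where
  "min_hom_gen_system f gs ds \<longleftrightarrow> hom_gen_system f gs ds \<and>
     (\<forall>gs' ds'. hom_gen_system f gs' ds' \<longrightarrow> length gs \<le> length gs')"

definition exponents :: "mpoly \<Rightarrow> nat list \<Rightarrow> bool" where
  "exponents f ds \<longleftrightarrow> sorted ds \<and> (\<exists>gs. min_hom_gen_system f gs ds)"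

definition free_curve :: "mpoly \<Rightarrow> bool" where
  "free_curve f \<longleftrightarrow> (\<exists>ds. exponents f ds \<and> length ds = 2)"

definition plus_one_generated :: "nat \<Rightarrow> mpoly \<Rightarrow> bool" where
  "plus_one_generated d f \<longleftrightarrow> (\<exists>ds. exponents f ds \<and> length ds = 3 \<and> ds ! 0 + ds ! 1 = d)"

end

theory Submission
  imports Defs "HOL-Computational_Algebra.Computational_Algebra"
    "HOL-Computational_Algebra.Field_as_Ring" "HOL-Library.Product_Plus"
begin

text \<open>Adding suitable multiples of the Euler field identifies the syzygies of f l with the submodule
N of those syzygies v of f for which l divides v(l). So N is free, with generators t1, t2; their
degrees e1, e2 add up to d, because their cross product is a constant multiple of the gradient
of f l (here reducedness and unique factorization enter).
The quotient of D0(f) by N is cyclic: multiplication by l embeds it into N / l N, a free module of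
rank two over the ring C[s,t] of the line, as a saturated submodule of rank one. Hence D0(f) is
generated by t1, t2 and one further syzygy w with l w = a t1 + b t2, where a and b are coprime
on the line. If a or b is a nonzero constant then t1 or t2 is redundant and f is free; otherwise w
has degree at least max(e1, e2), and e1 + e2 = d is the sum of the two smallest exponents.\<close>

subsection \<open>Homomorphisms from the polynomial ring\<close>

text \<open>Rank one alone does not give a single generator: the ideal (s,t) of C[s,t] has rank one
  and is not cyclic. Saturation is what closes the gap, and it comes from choosing w of least degree
  outside N. Rank one holds because otherwise Cramer's rule would make t1 and t2, hence all of N,
  vanish along the line, while the cross product of the gradients of l and f does not vanish there.
  The degree of w has to be compared with e1 and e2 because the plus-one condition concerns the two
  smallest exponents. Since l w has degree e + 1, a nonzero coefficient a requires e1 \<le> e + 1,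
  so e < e1 makes it a constant; if a vanishes, coprimality makes b a constant instead. Working in
  an affine chart of the line hides its point at infinity, so common zeros there are detected
  through degrees: every statement about restricted polynomials carries a degree bound.\<close>

abbreviation keys where "keys \<equiv> Poly_Mapping.keys"
abbreviation lookup where "lookup \<equiv> Poly_Mapping.lookup"
abbreviation single where "single \<equiv> Poly_Mapping.single"

lemma poly_mapping_sum_singles:
  fixes p :: "'a \<Rightarrow>\<^sub>0 'b::comm_monoid_add"
  shows "(\<Sum>t\<in>keys p. single t (lookup p t)) = p"
  by (rule poly_mapping_eqI)
    (auto simp: lookup_sum lookup_single when_def in_keys_iff)

text \<open>The premise \<open>t \<in> keys p\<close> hands support conditions on the whole
  polynomial, such as \<open>in_S\<close> or homogeneity, to the monomial case, while the additive
  case stays free of them.\<close>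

lemma poly_mapping_single_induct [case_names zero single add]:
  fixes p :: "'a \<Rightarrow>\<^sub>0 'b::comm_monoid_add"
  assumes "P 0" and "\<And>t a. t \<in> keys p \<Longrightarrow> P (single t a)" and "\<And>q r. P q \<Longrightarrow> P r \<Longrightarrow> P (q + r)"
  shows "P p"
proof -
  have "P (\<Sum>t\<in>A. single t (lookup p t))" if "finite A" "A \<subseteq> keys p" for A
    using that by (induction A rule: finite_induct) (auto intro: assms)
  from this[of "keys p"] show ?thesis by (simp add: poly_mapping_sum_singles)
qed

text \<open>Evaluation from values on coefficients and on monomials. The grading \<open>hp\<close>,
  the transport \<open>phi\<close> to iterated univariate polynomials and the restriction
  \<open>T\<close> to a line are instances, sharing one proof of multiplicativity.\<close>

definition ev :: "(complex \<Rightarrow> 'a) \<Rightarrow> ((nat \<Rightarrow>\<^sub>0 nat) \<Rightarrow> 'a) \<Rightarrow> mpoly \<Rightarrow> 'a::comm_ring_1" where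
  "ev c g p = (\<Sum>t\<in>keys p. c (lookup p t) * g t)"

locale mpoly_hom =
  fixes c :: "complex \<Rightarrow> 'a::comm_ring_1" and g :: "(nat \<Rightarrow>\<^sub>0 nat) \<Rightarrow> 'a"
  assumes c_add: "c (a + b) = c a + c b" and c_mult: "c (a * b) = c a * c b" and c_1: "c 1 = 1"
    and g_0: "g 0 = 1" and g_add: "g (s + t) = g s * g t"
begin

lemma c_0: "c 0 = 0"
  using c_add[of 0 0] by simp

lemma ev_superset: "finite A \<Longrightarrow> keys p \<subseteq> A \<Longrightarrow> ev c g p = (\<Sum>t\<in>A. c (lookup p t) * g t)"
  unfolding ev_def by (rule sum.mono_neutral_left) (auto simp: in_keys_iff c_0)

lemma ev_add: "ev c g (p + q) = ev c g p + ev c g q"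
proof -
  let ?A = "keys p \<union> keys q"
  have "keys (p + q) \<subseteq> ?A" by (rule Poly_Mapping.keys_add)
  then show ?thesis
    by (simp add: ev_superset[of ?A] lookup_add c_add algebra_simps sum.distrib)
qed

lemma ev_zero [simp]: "ev c g 0 = 0"
  by (simp add: ev_def)

lemma ev_single: "ev c g (single t a) = c a * g t"
  by (cases "a = 0") (simp_all add: ev_def c_0)

lemma ev_one [simp]: "ev c g 1 = 1"
  using ev_single[of 0 1] by (simp add: c_1 g_0)

lemma ev_mult: "ev c g (p * q) = ev c g p * ev c g q"
proof (induction p rule: poly_mapping_single_induct)
  case (single t a)
  show ?case
    by (induction q rule: poly_mapping_single_induct)
      (simp_all add: ev_add ev_single mult_single c_mult g_add algebra_simps)
qed (simp_all add: ev_add algebra_simps)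

lemma ev_uminus: "ev c g (- p) = - ev c g p"
  using ev_add[of p "- p"] by (simp add: eq_neg_iff_add_eq_0 add.commute)

lemma ev_diff: "ev c g (p - q) = ev c g p - ev c g q"
  using ev_add[of p "- q"] by (simp add: ev_uminus)

lemma ev_sum: "ev c g (sum h I) = (\<Sum>i\<in>I. ev c g (h i))"
  by (induction I rule: infinite_finite_induct) (simp_all add: ev_add)

lemma ev_power: "ev c g (p ^ n) = ev c g p ^ n"
  by (induction n) (simp_all add: ev_mult)

lemma ev_dvd: "p dvd q \<Longrightarrow> ev c g p dvd ev c g q"
  by (auto simp: dvd_def ev_mult)

end

section \<open>Polynomials in three variables and degrees of monomials\<close>

lemma in_S_0 [simp]: "in_S 0" and in_S_1 [simp]: "in_S 1"
  by (simp_all add: in_S_def)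

lemma in_S_add [simp]: "in_S p \<Longrightarrow> in_S q \<Longrightarrow> in_S (p + q)"
  unfolding in_S_def using Poly_Mapping.keys_add[of p q] by blast

lemma in_S_uminus_iff [simp]: "in_S (- p) \<longleftrightarrow> in_S p"
  by (simp add: in_S_def in_keys_iff)

lemma in_S_diff [simp]: "in_S p \<Longrightarrow> in_S q \<Longrightarrow> in_S (p - q)"
  using in_S_add[of p "- q"] by simp

lemma in_S_mult [simp]: "in_S p \<Longrightarrow> in_S q \<Longrightarrow> in_S (p * q)"
  unfolding in_S_def
proof
  fix t assume H: "\<forall>t\<in>keys p. keys t \<subseteq> {0, 1, 2}" "\<forall>t\<in>keys q. keys t \<subseteq> {0, 1, 2}" "t \<in> keys (p * q)"
  with keys_mult[of p q] obtain a b where "t = a + b" "a \<in> keys p" "b \<in> keys q" by blast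
  with H Poly_Mapping.keys_add[of a b] show "keys t \<subseteq> {0, 1, 2}" by blast
qed

lemma in_S_sum [simp]: "(\<And>i. i \<in> I \<Longrightarrow> in_S (h i)) \<Longrightarrow> in_S (sum h I)"
  by (induction I rule: infinite_finite_induct) simp_all

lemma in_S_single: "in_S (single t a) \<longleftrightarrow> a = 0 \<or> keys t \<subseteq> {0, 1, 2}"
  by (simp add: in_S_def)

definition const :: "complex \<Rightarrow> mpoly" where "const a = single 0 a"
definition var :: "nat \<Rightarrow> mpoly" where "var i = single (single i 1) 1"

lemma in_S_const [simp]: "in_S (const a)"
  by (simp add: const_def in_S_single)

lemma in_S_var [simp]: "i < 3 \<Longrightarrow> in_S (var i)"
  by (auto simp: var_def in_S_single)

lemma const_0 [simp]: "const 0 = 0" and const_1 [simp]: "const 1 = 1"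
  and const_add: "const (a + b) = const a + const b" and const_mult: "const (a * b) = const a * const b"
  and const_uminus: "const (- a) = - const a"
  by (simp_all add: const_def single_add mult_single single_uminus)

lemma const_eq_0_iff [simp]: "const a = 0 \<longleftrightarrow> a = 0"
  by (metis const_0 const_def lookup_single_eq)

lemma mon_deg_superset: "finite A \<Longrightarrow> keys t \<subseteq> A \<Longrightarrow> mon_deg t = (\<Sum>i\<in>A. lookup t i)"
  unfolding mon_deg_def by (rule sum.mono_neutral_left) (auto simp: in_keys_iff)

lemma mon_deg_0 [simp]: "mon_deg 0 = 0"
  by (simp add: mon_deg_def)

lemma mon_deg_add: "mon_deg (s + t) = mon_deg s + mon_deg t"
proof -
  let ?A = "keys s \<union> keys t"
  have "keys (s + t) \<subseteq> ?A" by (rule Poly_Mapping.keys_add)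
  then show ?thesis
    by (simp add: mon_deg_superset[of ?A] lookup_add sum.distrib)
qed

lemma mon_deg_single [simp]: "mon_deg (single i n) = n"
  by (cases "n = 0") (simp_all add: mon_deg_def)

subsection \<open>The grading\<close>

text \<open>The grading as a ring homomorphism: each variable x is sent to x u for a new variable u,
so the coefficient of u^k is the homogeneous component of degree k.\<close>

definition hp :: "mpoly \<Rightarrow> mpoly poly" where
  "hp = ev (\<lambda>a. [:const a:]) (\<lambda>t. monom (single t 1) (mon_deg t))"

interpretation hp: mpoly_hom "\<lambda>a. [:const a:]" "\<lambda>t. monom (single t 1 :: mpoly) (mon_deg t)"
  rewrites "ev (\<lambda>a. [:const a:]) (\<lambda>t. monom (single t 1) (mon_deg t)) = hp"
  by unfold_locales (simp_all add: const_add const_mult mon_deg_add mult_monom mult_single hp_def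
      flip: one_pCons monom_eq_1_iff)

lemma hp_single: "hp (single t a) = monom (single t a) (mon_deg t)"
  by (simp add: hp.ev_single const_def smult_monom mult_single)

definition hc :: "nat \<Rightarrow> mpoly \<Rightarrow> mpoly" where "hc k p = coeff (hp p) k"

lemma hc_add: "hc k (p + q) = hc k p + hc k q"
  by (simp add: hc_def hp.ev_add)

lemma hc_single: "hc k (single t a) = (if mon_deg t = k then single t a else 0)"
  by (simp add: hc_def hp_single)

lemma hc_0 [simp]: "hc k 0 = 0"
  by (simp add: hc_def)

lemma lookup_hc: "lookup (hc k p) t = (if mon_deg t = k then lookup p t else 0)"
proof (induction p rule: poly_mapping_single_induct)
  case (single s a)
  show ?case by (auto simp: hc_single lookup_single when_def)
qed (simp_all add: hc_add lookup_add)

lemma sum_hc: "(\<Sum>k\<le>degree (hp p). hc k p) = p"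
proof (rule poly_mapping_eqI)
  fix t
  have "mon_deg t \<le> degree (hp p)" if "lookup p t \<noteq> 0"
  proof (rule le_degree, rule notI)
    assume "coeff (hp p) (mon_deg t) = 0"
    then have "lookup (hc (mon_deg t) p) t = 0" by (simp add: hc_def)
    with that show False by (simp add: lookup_hc)
  qed
  then show "lookup (\<Sum>k\<le>degree (hp p). hc k p) t = lookup p t"
    by (cases "lookup p t = 0") (auto simp: lookup_sum lookup_hc)
qed

lemma homog_in_S: "homog k p \<Longrightarrow> in_S p"
  by (simp add: homog_def)

lemma homog_hc: "in_S p \<Longrightarrow> homog k (hc k p)"
  by (auto simp: homog_def in_S_def in_keys_iff lookup_hc split: if_splits)

lemma homog_iff_hp: "homog k p \<longleftrightarrow> in_S p \<and> hp p = monom p k"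
proof (intro iffI conjI)
  assume h: "homog k p"
  have "coeff (hp p) n = coeff (monom p k) n" for n
    unfolding hc_def[symmetric] coeff_monom
    by (rule poly_mapping_eqI) (use h in \<open>auto simp: lookup_hc homog_def in_keys_iff\<close>)
  then show "hp p = monom p k" by (simp add: poly_eq_iff)
next
  assume h: "in_S p \<and> hp p = monom p k"
  then have "hc k p = p" by (simp add: hc_def)
  with h homog_hc[of p k] show "homog k p" by simp
qed (simp add: homog_def)

lemma hp_eq_0_iff [simp]: "hp p = 0 \<longleftrightarrow> p = 0"
  using sum_hc[of p] by (auto simp: hc_def)

lemma hc_homog: "homog k p \<Longrightarrow> hc n p = (if n = k then p else 0)"
  by (auto simp: homog_iff_hp hc_def)

lemma homog_0 [simp]: "homog k 0"
  by (simp add: homog_iff_hp)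

lemma homog_add [intro]: "homog k p \<Longrightarrow> homog k q \<Longrightarrow> homog k (p + q)"
  by (simp add: homog_iff_hp hp.ev_add add_monom)

lemma homog_uminus [intro]: "homog k p \<Longrightarrow> homog k (- p)"
  by (simp add: homog_iff_hp hp.ev_uminus minus_monom)

lemma homog_diff [intro]: "homog k p \<Longrightarrow> homog k q \<Longrightarrow> homog k (p - q)"
  by (simp add: homog_iff_hp hp.ev_diff diff_monom)

lemma homog_mult [intro]: "homog j p \<Longrightarrow> homog k q \<Longrightarrow> homog (j + k) (p * q)"
  by (simp add: homog_iff_hp hp.ev_mult mult_monom)

lemma homog_sum [intro]: "(\<And>i. i \<in> I \<Longrightarrow> homog k (h i)) \<Longrightarrow> homog k (sum h I)"
  by (induction I rule: infinite_finite_induct) auto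

lemma homog_1 [simp]: "homog 0 1"
  by (simp add: homog_iff_hp flip: monom_eq_1)

lemma homog_power: "homog k p \<Longrightarrow> homog (n * k) (p ^ n)"
  by (induction n) auto

lemma homog_const [simp]: "homog 0 (const a)"
  by (simp add: homog_iff_hp const_def hp_single in_S_single)

lemma homog_var [simp]: "i < 3 \<Longrightarrow> homog 1 (var i)"
  by (auto simp: homog_iff_hp var_def hp_single in_S_single)

lemma homog_const_mult: "homog k p \<Longrightarrow> homog k (const a * p)"
  using homog_mult[OF homog_const, of k p a] by simp

lemma hc_mult:
  assumes "homog j q"
  shows "hc k (q * p) = (if j \<le> k then q * hc (k - j) p else 0)"
  using assms by (simp add: hc_def hp.ev_mult homog_iff_hp coeff_monom_mult)

text \<open>The degree k component of q p is q times a component of p, and q cancels.\<close>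

lemma homog_cofactor:
  assumes "homog j q" "q \<noteq> 0" "in_S p" "homog k (q * p)" "p \<noteq> 0"
  shows "j \<le> k \<and> homog (k - j) p"
proof -
  have *: "q * p = (if j \<le> k then q * hc (k - j) p else 0)"
    using hc_mult[OF assms(1), of k p] hc_homog[OF assms(4), of k] by simp
  show ?thesis
  proof (cases "j \<le> k")
    case True
    with * assms have "p = hc (k - j) p" by auto
    with True homog_hc[OF assms(3), of "k - j"] show ?thesis by simp
  qed (use * assms in auto)
qed

lemma const_hc_0: "hc 0 p = const (lookup p 0)"
proof (rule poly_mapping_eqI)
  fix t
  show "lookup (hc 0 p) t = lookup (const (lookup p 0)) t"
  proof (cases "t = 0")
    case False
    show ?thesis
    proof (cases "mon_deg t = 0")
      case True
      then have "lookup t i = 0" for i by (simp add: mon_deg_def) (meson in_keys_iff)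
      then have "t = 0" by (simp add: poly_mapping_eq_iff fun_eq_iff)
      with False show ?thesis by simp
    qed (use False in \<open>simp add: lookup_hc const_def lookup_single_not_eq\<close>)
  qed (simp add: lookup_hc const_def)
qed

lemma homog_0_const: "homog 0 p \<Longrightarrow> p = const (lookup p 0)"
  using const_hc_0[of p] hc_homog[of 0 p 0] by simp

lemma homogI: "in_S p \<Longrightarrow> (\<And>n. n \<noteq> k \<Longrightarrow> hc n p = 0) \<Longrightarrow> homog k p"
  unfolding homog_def by (metis in_keys_iff lookup_hc lookup_zero)

lemma degree_hp_0: "degree (hp p) = 0 \<Longrightarrow> p = const (lookup p 0)"
  using sum_hc[of p] by (simp add: const_hc_0)

lemma const_dvd_1: "a \<noteq> 0 \<Longrightarrow> const a dvd 1"
  by (rule dvdI[of _ _ "const (1 / a)"]) (simp flip: const_mult)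

subsection \<open>Unique factorization\<close>

text \<open>Iterated univariate polynomials over a field form a factorial ring, from which primes
  and multiplicities are borrowed. All variables beyond x, y, z are sent to 1, so \<open>phi\<close>
  is injective only on S.\<close>

definition phi :: "mpoly \<Rightarrow> complex poly poly poly" where
  "phi = ev (\<lambda>a. [:[:[:a:]:]:]) (\<lambda>t. monom (monom (monom 1 (lookup t 0)) (lookup t 1)) (lookup t 2))"

interpretation phi: mpoly_hom "\<lambda>a. [:[:[:a:]:]:]"
    "\<lambda>t. monom (monom (monom 1 (lookup t 0)) (lookup t 1)) (lookup t 2)"
  rewrites "ev (\<lambda>a. [:[:[:a:]:]:]) (\<lambda>t. monom (monom (monom 1 (lookup t 0)) (lookup t 1)) (lookup t 2)) = phi"
  by unfold_locales (simp_all add: lookup_add mult_monom phi_def flip: one_pCons)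

lemma phi_single:
  "phi (single t a) = monom (monom (monom a (lookup t 0)) (lookup t 1)) (lookup t 2)"
  by (simp add: phi.ev_single smult_monom)

lemma coeff_phi:
  assumes "in_S p" "keys t \<subseteq> {0, 1, 2}"
  shows "coeff (coeff (coeff (phi p) (lookup t 2)) (lookup t 1)) (lookup t 0) = lookup p t"
proof (induction p rule: poly_mapping_single_induct)
  case (single s a)
  then have s: "keys s \<subseteq> {0, 1, 2}" using assms(1) by (auto simp: in_S_def)
  have "s = t" if h: "lookup s 0 = lookup t 0" "lookup s 1 = lookup t 1" "lookup s 2 = lookup t 2"
  proof (rule poly_mapping_eqI)
    fix i
    show "lookup s i = lookup t i"
    proof (cases "i \<in> {0, 1, 2}")
      case False
      then have "i \<notin> keys s" "i \<notin> keys t" using s assms(2) by blast+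
      then show ?thesis by (simp add: in_keys_iff)
    qed (use h in auto)
  qed
  then show ?case by (auto simp: phi_single lookup_single when_def)
qed (simp_all add: phi.ev_add lookup_add)

lemma phi_eq_0: "in_S p \<Longrightarrow> phi p = 0 \<Longrightarrow> p = 0"
proof (rule poly_mapping_eqI)
  fix t assume "in_S p" "phi p = 0"
  then show "lookup p t = lookup 0 t"
    using coeff_phi[of p t] by (cases "t \<in> keys p") (auto simp: in_S_def in_keys_iff)
qed

lemma phi_inj: "in_S p \<Longrightarrow> in_S q \<Longrightarrow> phi p = phi q \<Longrightarrow> p = q"
  using phi_eq_0[of "p - q"] by (simp add: phi.ev_diff)

text \<open>The image is closed under sums and products and contains the constants and the three
  variables; each layer of polynomials takes one induction.\<close>

lemma phi_surj: "\<exists>p. in_S p \<and> phi p = Q"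
proof -
  have add: "\<exists>p. in_S p \<and> phi p = A + B" if "\<exists>p. in_S p \<and> phi p = A" "\<exists>p. in_S p \<and> phi p = B" for A B
    using that phi.ev_add in_S_add by metis
  have mult: "\<exists>p. in_S p \<and> phi p = A * B" if "\<exists>p. in_S p \<and> phi p = A" "\<exists>p. in_S p \<and> phi p = B" for A B
    using that phi.ev_mult in_S_mult by metis
  have c: "\<exists>p. in_S p \<and> phi p = [:[:[:a:]:]:]" for a
    by (rule exI[of _ "const a"]) (simp add: const_def phi_single in_S_single monom_0)
  have v0: "\<exists>p. in_S p \<and> phi p = [:[:[:0, 1:]:]:]"
    by (rule exI[of _ "var 0"]) (simp add: var_def phi_single in_S_single lookup_single monom_0 monom_Suc)
  have v1: "\<exists>p. in_S p \<and> phi p = [:[:0, 1:]:]"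
    by (rule exI[of _ "var 1"]) (simp add: var_def phi_single in_S_single lookup_single monom_0 monom_Suc one_pCons)
  have v2: "\<exists>p. in_S p \<and> phi p = [:0, 1:]"
    by (rule exI[of _ "var 2"]) (simp add: var_def phi_single in_S_single lookup_single monom_0 monom_Suc one_pCons)
  have 1: "\<exists>p. in_S p \<and> phi p = [:[:q:]:]" for q
  proof (induction q)
    case (pCons a q)
    show ?case using add[OF c[of a] mult[OF v0 pCons.IH]] by simp
  qed (use c[of 0] in simp)
  have 2: "\<exists>p. in_S p \<and> phi p = [:q:]" for q
  proof (induction q)
    case (pCons a q)
    show ?case using add[OF 1[of a] mult[OF v1 pCons.IH]] by simp
  qed (use c[of 0] in simp)
  show ?thesis
  proof (induction Q)
    case (pCons a q)
    show ?case using add[OF 2[of a] mult[OF v2 pCons.IH]] by simp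
  qed (use c[of 0] in simp)
qed

text \<open>A quotient in the ambient ring might involve further variables; passing through
  \<open>phi\<close> sets them to 1 and yields a quotient in S.\<close>

lemma in_S_dvdE:
  assumes "in_S p" "in_S q" "p dvd q"
  obtains r where "in_S r" "q = p * r"
proof -
  from assms(3) obtain r where r: "q = p * r" by blast
  obtain r' where r': "in_S r'" "phi r' = phi r" using phi_surj by blast
  then have "phi q = phi (p * r')" by (simp add: r phi.ev_mult)
  with assms r' have "q = p * r'" by (intro phi_inj) auto
  with r' that show thesis by blast
qed

lemma phi_dvd_iff: "in_S p \<Longrightarrow> in_S q \<Longrightarrow> phi p dvd phi q \<longleftrightarrow> p dvd q"
proof
  assume h: "in_S p" "in_S q" "phi p dvd phi q"
  then obtain R where R: "phi q = phi p * R" by blast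
  obtain r where r: "in_S r" "phi r = R" using phi_surj by blast
  have "q = p * r" by (rule phi_inj) (use h R r in \<open>simp_all add: phi.ev_mult\<close>)
  then show "p dvd q" by simp
qed (rule phi.ev_dvd)

lemma phi_unit_iff: "in_S p \<Longrightarrow> phi p dvd 1 \<longleftrightarrow> p dvd 1"
  using phi_dvd_iff[of p 1] by simp

subsection \<open>Partial derivatives\<close>

lemma pdiff_superset:
  assumes "finite A" "keys p \<subseteq> A"
  shows "pdiff i p = (\<Sum>t\<in>A. single (t - single i 1) (of_nat (lookup t i) * lookup p t))"
  unfolding pdiff_def using assms by (intro sum.mono_neutral_left) (auto simp: in_keys_iff)

lemma pdiff_add: "pdiff i (p + q) = pdiff i p + pdiff i q"
proof -
  let ?A = "keys p \<union> keys q"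
  have "keys (p + q) \<subseteq> ?A" by (rule Poly_Mapping.keys_add)
  then show ?thesis
    by (simp add: pdiff_superset[of ?A] lookup_add algebra_simps single_add sum.distrib)
qed

lemma pdiff_0 [simp]: "pdiff i 0 = 0"
  by (simp add: pdiff_def)

lemma pdiff_single: "pdiff i (single t a) = single (t - single i 1) (of_nat (lookup t i) * a)"
  by (cases "a = 0") (simp_all add: pdiff_def)

lemma lookup_minus_nat: "lookup (s - t :: nat \<Rightarrow>\<^sub>0 nat) i = lookup s i - lookup t i"
  by transfer simp

lemma minus_single_add:
  fixes s t :: "nat \<Rightarrow>\<^sub>0 nat"
  assumes "lookup s i \<noteq> 0"
  shows "s - single i 1 + t = s + t - single i 1"
  by (rule poly_mapping_eqI)
    (use assms in \<open>auto simp: lookup_add lookup_minus_nat lookup_single when_def\<close>)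

lemma pdiff_mult: "pdiff i (p * q) = p * pdiff i q + q * pdiff i p"
proof (induction p rule: poly_mapping_single_induct)
  case (single s a)
  show ?case
  proof (induction q rule: poly_mapping_single_induct)
    case (single t b)
    \<comment> \<open>Where the exponent of the variable is zero, truncated subtraction gives a
      wrong exponent vector, but the coefficient vanishes.\<close>
    have *: "single (s + (t - single i 1)) (of_nat (lookup t i) * c) =
        single (s + t - single i 1) (of_nat (lookup t i) * c)" for c :: complex
      using minus_single_add[of t i s] by (cases "lookup t i = 0") (simp_all add: add.commute)
    have **: "single (s - single i 1 + t) (of_nat (lookup s i) * c) =
        single (s + t - single i 1) (of_nat (lookup s i) * c)" for c :: complex
      using minus_single_add[of s i t] by (cases "lookup s i = 0") simp_all
    show ?case
      using *[of "a * b"] **[of "a * b"]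
      by (simp add: mult_single pdiff_single lookup_add algebra_simps flip: single_add)
  qed (simp_all add: pdiff_add algebra_simps)
qed (simp_all add: pdiff_add algebra_simps)

lemma in_S_pdiff [simp]: "in_S p \<Longrightarrow> in_S (pdiff i p)"
  unfolding pdiff_def
proof (rule in_S_sum)
  fix t assume "in_S p" "t \<in> keys p"
  then have "keys t \<subseteq> {0, 1, 2}" by (auto simp: in_S_def)
  moreover have "keys (t - single i 1) \<subseteq> keys t" by (auto simp: in_keys_iff lookup_minus_nat)
  ultimately show "in_S (single (t - single i 1) (of_nat (lookup t i) * lookup p t))"
    by (auto simp: in_S_single)
qed

lemma hc_pdiff: "hc n (pdiff i p) = pdiff i (hc (Suc n) p)"
proof (induction p rule: poly_mapping_single_induct)
  case (single t a)
  show ?case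
  proof (cases "lookup t i = 0")
    case False
    have "t - single i 1 + single i 1 = t"
      by (rule poly_mapping_eqI)
        (use False in \<open>auto simp: lookup_add lookup_minus_nat lookup_single when_def\<close>)
    then have "mon_deg t = Suc (mon_deg (t - single i 1))"
      using mon_deg_add[of "t - single i 1" "single i 1"] by simp
    then show ?thesis by (simp add: pdiff_single hc_single)
  qed (simp add: pdiff_single hc_single)
qed (simp_all add: pdiff_add hc_add)

lemma homog_pdiff: "homog (Suc k) p \<Longrightarrow> homog k (pdiff i p)"
  by (rule homogI) (auto simp: hc_pdiff hc_homog homog_in_S)

lemma euler:
  assumes "homog k p"
  shows "var 0 * pdiff 0 p + var 1 * pdiff 1 p + var 2 * pdiff 2 p = const (of_nat k) * p"
proof (induction p rule: poly_mapping_single_induct)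
  case (single t a)
  have *: "var i * pdiff i (single t a) = single t (of_nat (lookup t i) * a)" for i
  proof (cases "lookup t i = 0")
    case False
    have "single i 1 + (t - single i 1) = t"
      by (rule poly_mapping_eqI)
        (use False in \<open>auto simp: lookup_add lookup_minus_nat lookup_single when_def\<close>)
    then show ?thesis by (simp add: var_def pdiff_single mult_single)
  qed (simp add: pdiff_single)
  have "mon_deg t = (\<Sum>i\<in>{0, 1, 2}. lookup t i)"
    using single assms by (intro mon_deg_superset) (auto simp: homog_def in_S_def)
  moreover have "mon_deg t = k" using single assms by (simp add: homog_def)
  ultimately have "k = lookup t 0 + lookup t 1 + lookup t 2" by simp
  then show ?case
    by (simp add: * const_def mult_single ring_distribs flip: single_add)
next
  case (add q r)
  show ?case
    by (simp only: pdiff_add distrib_left flip: add) (simp only: ac_simps)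
qed simp

text \<open>\<open>degree (hp p)\<close> is the total degree. It is the right measure for the prime
  factors met below, which are not known to be homogeneous.\<close>

lemma degree_hp_pdiff:
  assumes "pdiff i p \<noteq> 0"
  shows "degree (hp (pdiff i p)) < degree (hp p)"
proof -
  let ?n = "degree (hp (pdiff i p))"
  have "hc ?n (pdiff i p) \<noteq> 0" using assms by (simp add: hc_def)
  then have "hc (Suc ?n) p \<noteq> 0" by (auto simp: hc_pdiff)
  then show ?thesis by (simp add: hc_def le_degree Suc_le_lessD)
qed

text \<open>Euler's formula, applied to each component of positive degree, kills that component
  since its degree is invertible in C.\<close>

lemma pdiff_eq_0_imp_const:
  assumes "in_S p" "pdiff 0 p = 0" "pdiff 1 p = 0" "pdiff 2 p = 0"
  shows "p = const (lookup p 0)"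
proof -
  have "hc (Suc n) p = 0" for n
    using euler[OF homog_hc[OF assms(1), of "Suc n"]] assms(2-4) by (simp del: of_nat_Suc flip: hc_pdiff)
  then have "degree (hp p) = 0"
    by (metis hc_def leading_coeff_0_iff not0_implies_Suc degree_0)
  then show ?thesis by (rule degree_hp_0)
qed

subsection \<open>Reduced polynomials\<close>

lemma reduced_not_square_dvd:
  assumes "reduced f" "prime p"
  shows "\<not> p\<^sup>2 dvd phi f"
proof
  assume h: "p\<^sup>2 dvd phi f"
  obtain q where q: "in_S q" "phi q = p" using phi_surj by blast
  with h have "phi (q * q) dvd phi f" by (simp add: phi.ev_mult power2_eq_square)
  with assms q have "q * q dvd f" by (subst (asm) phi_dvd_iff) (auto simp: reduced_def)
  with assms q have "q dvd 1" by (auto simp: reduced_def)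
  with q assms(2) show False by (auto simp flip: phi_unit_iff)
qed

text \<open>A prime factor of f dividing all the partial derivatives of f would be a multiple factor,
or have vanishing partial derivatives.\<close>

lemma reduced_dvd:
  assumes "reduced f" "in_S u" and dvd: "\<And>i. i < 3 \<Longrightarrow> f dvd u * pdiff i f"
  shows "f dvd u"
proof (cases "u = 0")
  case False
  have f: "in_S f" "f \<noteq> 0" using assms(1) by (auto simp: reduced_def)
  have "phi f dvd phi u"
  proof (rule multiplicity_le_imp_dvd)
    fix p :: "complex poly poly poly" assume p: "prime p"
    show "multiplicity p (phi f) \<le> multiplicity p (phi u)"
    proof (cases "p dvd phi f")
      case True
      \<comment> \<open>Reducedness caps the multiplicity of p in f at one, so it remains to see
        that p divides u.\<close>
      have "multiplicity p (phi f) < 2"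
        using reduced_not_square_dvd[OF assms(1) p] p f phi_eq_0 by (intro multiplicity_lessI) auto
      moreover have "p dvd phi u"
      proof (rule ccontr)
        assume pu: "\<not> p dvd phi u"
        obtain q where q: "in_S q" "phi q = p" using phi_surj by blast
        with True f have "q dvd f" by (simp flip: phi_dvd_iff)
        then obtain r where r: "in_S r" "f = q * r" using in_S_dvdE[OF q(1) f(1)] by blast
        have pr: "\<not> p dvd phi r"
          using reduced_not_square_dvd[OF assms(1) p] q r by (auto simp: phi.ev_mult power2_eq_square)
        \<comment> \<open>By the product rule q would divide its own derivative, which has smaller
          total degree.\<close>
        have "pdiff i q = 0" if i: "i < 3" for i
        proof (rule ccontr)
          assume nz: "pdiff i q \<noteq> 0"
          have "p dvd phi (u * pdiff i f)"
            using True phi.ev_dvd[OF dvd[OF i]] dvd_trans by blast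
          with p pu have "p dvd phi (pdiff i f)" by (simp add: phi.ev_mult prime_dvd_mult_iff)
          then have "p dvd p * phi (pdiff i r) + phi r * phi (pdiff i q)"
            by (simp add: r pdiff_mult phi.ev_mult phi.ev_add q)
          then have "p dvd phi r * phi (pdiff i q)" by (simp add: dvd_add_right_iff)
          with p pr have "phi q dvd phi (pdiff i q)" by (simp add: prime_dvd_mult_iff q)
          with q(1) have "q dvd pdiff i q" by (simp add: phi_dvd_iff)
          then obtain s where "pdiff i q = q * s" ..
          with nz have "degree (hp (pdiff i q)) = degree (hp q) + degree (hp s)"
            by (simp add: hp.ev_mult degree_mult_eq)
          with degree_hp_pdiff[OF nz] show False by simp
        qed
        with q have "q = const (lookup q 0)" by (intro pdiff_eq_0_imp_const) auto
        moreover have "lookup q 0 \<noteq> 0" using calculation q p by (metis const_0 phi.ev_zero not_prime_0)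
        ultimately have "q dvd 1" by (metis const_dvd_1)
        with q p show False by (auto simp flip: phi_unit_iff)
      qed
      then have "multiplicity p (phi u) \<ge> 1"
        using p phi_eq_0[OF assms(2)] False by (intro multiplicity_geI) auto
      ultimately show ?thesis by simp
    qed (simp add: not_dvd_imp_multiplicity_0)
  qed (use f phi_eq_0 in auto)
  with assms(2) f show ?thesis by (simp add: phi_dvd_iff)
qed simp

text \<open>Let p be a prime whose square divides f l. If p does not divide l, then its square
  divides f. Otherwise p is an associate of l, a linear form having only trivial factorizations, and
  l would divide f.\<close>

lemma reduced_mult_linear:
  assumes f: "reduced f" and l: "homog 1 l" "l \<noteq> 0" "\<not> l dvd f"
  shows "reduced (f * l)"
  unfolding reduced_def
proof (intro conjI allI impI)
  have S: "in_S f" "in_S l" "f \<noteq> 0" using f l by (auto simp: reduced_def homog_def)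
  then show "in_S (f * l)" "f * l \<noteq> 0" using l by auto
  fix g assume g: "in_S g \<and> g * g dvd f * l"
  show "g dvd 1"
  proof (rule ccontr)
    assume "\<not> g dvd 1"
    with g have "\<not> phi g dvd 1" by (simp add: phi_unit_iff)
    moreover have "phi g \<noteq> 0" using g S l phi_eq_0[of g] by auto
    ultimately obtain p where p: "prime p" "p dvd phi g" using prime_divisorE by blast
    have "p\<^sup>2 dvd phi g * phi g" using p by (simp add: power2_eq_square mult_dvd_mono)
    also have "\<dots> dvd phi f * phi l" using g phi.ev_dvd[of "g * g" "f * l"] by (simp add: phi.ev_mult)
    finally have p2: "p\<^sup>2 dvd phi f * phi l" .
    obtain q where q: "in_S q" "phi q = p" using phi_surj by blast
    show False
    proof (cases "p dvd phi l")
      case False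
      with p have "coprime p (phi l)" by (intro prime_imp_coprime)
      then have "coprime (p\<^sup>2) (phi l)" by simp
      with p2 have "p\<^sup>2 dvd phi f" by (simp add: coprime_dvd_mult_left_iff)
      with reduced_not_square_dvd[OF f p(1)] show False by simp
    next
      case True
      with q S have "q dvd l" by (simp flip: phi_dvd_iff)
      then obtain r where r: "in_S r" "l = q * r" using in_S_dvdE[OF q(1) S(2)] by blast
      have qr: "q \<noteq> 0" "r \<noteq> 0" using r l by auto
      have "degree (hp q) + degree (hp r) = degree (hp l)"
        using qr by (simp add: r hp.ev_mult degree_mult_eq)
      also have "\<dots> = 1" using l by (simp add: homog_iff_hp degree_monom_eq)
      finally consider "degree (hp q) = 0" | "degree (hp r) = 0" by linarith
      then show False
      proof cases
        case 1
        then have "q dvd 1" using qr by (metis degree_hp_0 const_dvd_1 const_0)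
        with q p show False by (auto simp flip: phi_unit_iff)
      next
        case 2
        then have "r dvd 1" using qr by (metis degree_hp_0 const_dvd_1 const_0)
        then have "l dvd q" by (simp add: r)
        with S q have "phi l dvd phi g" using p by (metis phi.ev_dvd dvd_trans)
        then have "l dvd g" using S g by (simp add: phi_dvd_iff)
        then have "l * l dvd f * l" using g by (meson dvd_trans mult_dvd_mono)
        with l show False by simp
      qed
    qed
  qed
qed

subsection \<open>Restriction to a line\<close>

text \<open>T restricts a polynomial to the line l = 0, parametrized by x_j = s, x_k = 1; on forms of
degree n it is inverted modulo l by homogenizing with respect to x_j and x_k.\<close>

locale line =
  fixes l :: mpoly and i j k :: nat and zi zj zk :: complex
  assumes l_eq: "l = const zi * var i + const zj * var j + const zk * var k"
    and l_nonzero: "l \<noteq> 0" and zi_nonzero: "zi \<noteq> 0"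
    and ijk_less: "i < 3" "j < 3" "k < 3" and ijk_distinct: "i \<noteq> j" "i \<noteq> k" "j \<noteq> k"
begin

lemma homog_l: "homog 1 l"
  unfolding l_eq using ijk_less by (intro homog_add homog_const_mult homog_var)

lemma in_S_l [simp]: "in_S l"
  using homog_l by (rule homog_in_S)

text \<open>Solving l = 0 for x_i at x_j = s, x_k = 1 gives x_i = -(zk + zj s)/zi.\<close>

definition X :: "nat \<Rightarrow> complex poly" where
  "X m = (if m = i then [:- zk / zi, - zj / zi:] else if m = j then [:0, 1:] else 1)"

definition T :: "mpoly \<Rightarrow> complex poly" where
  "T = ev (\<lambda>z. [:z:]) (\<lambda>t. X 0 ^ lookup t 0 * X 1 ^ lookup t 1 * X 2 ^ lookup t 2)"

sublocale T: mpoly_hom "\<lambda>z. [:z:]" "\<lambda>t. X 0 ^ lookup t 0 * X 1 ^ lookup t 1 * X 2 ^ lookup t 2"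
  rewrites "ev (\<lambda>z. [:z:]) (\<lambda>t. X 0 ^ lookup t 0 * X 1 ^ lookup t 1 * X 2 ^ lookup t 2) = T"
  by unfold_locales (simp_all add: lookup_add power_add T_def flip: one_pCons)

lemma T_const [simp]: "T (const z) = [:z:]"
  by (simp add: const_def T.ev_single)

lemma T_var: "m < 3 \<Longrightarrow> T (var m) = X m"
proof -
  assume "m < 3"
  then consider "m = 0" | "m = 1" | "m = 2" by linarith
  then show ?thesis by cases (simp_all add: var_def T.ev_single lookup_single one_pCons)
qed

lemma T_var_ijk: "T (var i) = [:- zk / zi, - zj / zi:]" "T (var j) = [:0, 1:]" "T (var k) = 1"
  using ijk_less ijk_distinct by (simp_all add: T_var X_def)

lemma T_l [simp]: "T l = 0"
  using zi_nonzero by (simp add: l_eq T.ev_add T.ev_mult T_var_ijk one_pCons)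

lemma T_dvd: "l dvd p \<Longrightarrow> T p = 0"
  by (auto simp: T.ev_mult)

text \<open>The target degree n is a parameter because setting x_k = 1 forgets it: a zero at the
  point x_k = 0 lowers the degree of the restriction.\<close>

definition lift :: "nat \<Rightarrow> complex poly \<Rightarrow> mpoly" where
  "lift n q = (\<Sum>m\<le>n. const (coeff q m) * (var j ^ m * var k ^ (n - m)))"

lemma homog_lift [simp]: "homog n (lift n q)"
  unfolding lift_def
proof (rule homog_sum)
  fix m assume "m \<in> {..n}"
  then have n: "0 + (m * 1 + (n - m) * 1) = n" by simp
  have "homog (0 + (m * 1 + (n - m) * 1)) (const (coeff q m) * (var j ^ m * var k ^ (n - m)))"
    by (intro homog_mult homog_const homog_power homog_var ijk_less)
  then show "homog n (const (coeff q m) * (var j ^ m * var k ^ (n - m)))"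
    unfolding n .
qed

lemma in_S_lift [simp]: "in_S (lift n q)"
  using homog_lift by (rule homog_in_S)

lemma T_lift: "degree q \<le> n \<Longrightarrow> T (lift n q) = q"
  using poly_as_sum_of_monoms'[of q n]
  by (simp add: lift_def T.ev_sum T.ev_mult T.ev_power T_var_ijk monom_altdef)

lemma lift_0 [simp]: "lift n 0 = 0"
  by (simp add: lift_def)

lemma lift_add: "lift n (p + q) = lift n p + lift n q"
  by (simp add: lift_def const_add algebra_simps sum.distrib)

lemma lift_smult: "lift n (smult z q) = const z * lift n q"
  by (simp add: lift_def const_mult sum_distrib_left mult.assoc)

lemma lift_Suc: "degree q \<le> n \<Longrightarrow> lift (Suc n) q = var k * lift n q"
  by (simp add: lift_def coeff_eq_0 sum_distrib_left Suc_diff_le mult_ac)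

lemma lift_pCons_0: "lift (Suc n) (pCons 0 q) = var j * lift n q"
  by (simp add: lift_def sum.atMost_Suc_shift sum_distrib_left mult_ac del: sum.atMost_Suc)

text \<open>The degree bound is carried along because \<open>lift (Suc n) q\<close> equals x_k times
  \<open>lift n q\<close> only when q has degree at most n.\<close>

definition restrictable :: "nat \<Rightarrow> mpoly \<Rightarrow> bool" where
  "restrictable n p \<longleftrightarrow> degree (T p) \<le> n \<and> l dvd p - lift n (T p)"

text \<open>On lifts, x_j acts as a shift of coefficients and x_k as a change of n; modulo l, x_i is
  a combination of the two.\<close>

lemma restrictable_var:
  assumes "restrictable n p" "m < 3"
  shows "restrictable (Suc n) (var m * p)"
proof -
  have deg: "degree (T p) \<le> n" and "l dvd p - lift n (T p)"
    using assms(1) by (auto simp: restrictable_def)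
  then obtain r where "p - lift n (T p) = l * r" by blast
  then have r: "p = lift n (T p) + l * r" by (simp add: algebra_simps)
  have deg': "degree (pCons 0 (T p)) \<le> Suc n" using deg by (simp add: degree_pCons_le le_trans)
  consider "m = i" | "m = j" | "m = k"
    using assms(2) ijk_less ijk_distinct by linarith
  then show ?thesis
  proof cases
    case 1
    have "T (var m * p) = [:- zk / zi, - zj / zi:] * T p"
      by (simp only: 1 T.ev_mult T_var_ijk)
    also have "\<dots> = smult (- zk / zi) (T p) + smult (- zj / zi) (pCons 0 (T p))"
      by simp
    finally have eq: "T (var m * p) = smult (- zk / zi) (T p) + smult (- zj / zi) (pCons 0 (T p))" .
    have "const (1 / zi) * l = const (1 / zi * zi) * var i + const (1 / zi * zj) * var j + const (1 / zi * zk) * var k"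
      unfolding const_mult by (simp add: l_eq distrib_left mult.assoc)
    then have vi: "var i = const (1 / zi) * l + const (- zk / zi) * var k + const (- zj / zi) * var j"
      using zi_nonzero by (simp add: const_uminus)
    have "var i * p - (const (- zk / zi) * (var k * lift n (T p)) + const (- zj / zi) * (var j * lift n (T p)))
        = l * (var i * r + const (1 / zi) * lift n (T p))"
      using r vi by algebra
    then have "var m * p - lift (Suc n) (T (var m * p)) = l * (var i * r + const (1 / zi) * lift n (T p))"
      unfolding eq lift_add lift_smult lift_pCons_0 lift_Suc[OF deg] unfolding 1 .
    moreover have "degree (T (var m * p)) \<le> Suc n"
      unfolding eq using deg deg' by (intro degree_add_le order.trans[OF degree_smult_le]) auto
    ultimately show ?thesis by (simp add: restrictable_def)
  next
    case 2
    have eq: "T (var m * p) = pCons 0 (T p)"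
      by (simp add: 2 T.ev_mult T_var_ijk)
    have "var j * p - var j * lift n (T p) = l * (var j * r)"
      using r by algebra
    then have "l dvd var m * p - lift (Suc n) (T (var m * p))"
      unfolding eq lift_pCons_0 unfolding 2 by (metis dvd_triv_left)
    then show ?thesis using deg' by (simp only: restrictable_def eq)
  next
    case 3
    have eq: "T (var m * p) = T p"
      by (simp add: 3 T.ev_mult T_var_ijk)
    have "var k * p - var k * lift n (T p) = l * (var k * r)"
      using r by algebra
    then have "l dvd var m * p - lift (Suc n) (T (var m * p))"
      unfolding eq lift_Suc[OF deg] unfolding 3 by (metis dvd_triv_left)
    then show ?thesis using deg by (simp add: restrictable_def eq)
  qed
qed

lemma restrictable_monomial:
  assumes "keys t \<subseteq> {0, 1, 2}"
  shows "restrictable (mon_deg t) (single t z)"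
  using assms
proof (induction "mon_deg t" arbitrary: t)
  case 0
  then have "homog 0 (single t z)" by (simp add: homog_def in_S_single)
  then have "single t z = const (lookup (single t z) 0)" by (rule homog_0_const)
  moreover have "restrictable 0 (const y)" for y by (simp add: restrictable_def lift_def)
  ultimately show ?case using 0 by metis
next
  case (Suc n)
  then have "keys t \<noteq> {}" by (auto simp: mon_deg_def)
  then obtain m where m: "m \<in> keys t" by blast
  let ?s = "t - single m 1"
  have t: "t = single m 1 + ?s"
    by (rule poly_mapping_eqI)
      (use m in \<open>auto simp: lookup_add lookup_minus_nat lookup_single when_def in_keys_iff\<close>)
  have "mon_deg t = 1 + mon_deg ?s" by (subst t) (simp add: mon_deg_add)
  then have s: "mon_deg ?s = n" using Suc by simp
  have "keys ?s \<subseteq> keys t" by (auto simp: in_keys_iff lookup_minus_nat)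
  with Suc s have "restrictable n (single ?s z)" by auto
  moreover have "m < 3" using m Suc.prems by auto
  ultimately have "restrictable (Suc n) (var m * single ?s z)" by (rule restrictable_var)
  moreover have "var m * single ?s z = single t z" using t by (simp add: var_def mult_single)
  ultimately show ?case using Suc by simp
qed

lemma homog_restrictable:
  assumes "homog n p"
  shows "restrictable n p"
proof (induction p rule: poly_mapping_single_induct)
  case (single t z)
  then show ?case using assms restrictable_monomial[of t] by (auto simp: homog_def in_S_def)
next
  case (add q r)
  then have "l dvd (q - lift n (T q)) + (r - lift n (T r))" by (auto simp: restrictable_def)
  with add show ?case by (simp add: restrictable_def T.ev_add lift_add degree_add_le add_diff_add)
qed (simp add: restrictable_def)

lemma degree_T: "homog n p \<Longrightarrow> degree (T p) \<le> n"
  using homog_restrictable by (simp add: restrictable_def)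

text \<open>For a form the chart x_k = 1 sees the whole line, since p is congruent to the lift of
  its restriction. Without homogeneity this fails, as for x_k - 1.\<close>

lemma dvd_homog_iff: "homog n p \<Longrightarrow> l dvd p \<longleftrightarrow> T p = 0"
  using homog_restrictable[of n p] by (auto simp: restrictable_def T_dvd)

end

lemma linear_form_line:
  assumes "homog 1 l" "l \<noteq> 0"
  obtains i j k zi zj zk where "line l i j k zi zj zk"
proof -
  \<comment> \<open>By Euler's formula the coefficients of a linear form are its partial
    derivatives; a nonzero one selects the variable to eliminate.\<close>
  define z where "z i = lookup (pdiff i l) 0" for i
  have "pdiff i l = const (z i)" for i
    using homog_pdiff[of 0 l i] assms by (simp add: z_def homog_0_const[symmetric])
  with euler[OF assms(1)] have l: "l = var 0 * const (z 0) + var 1 * const (z 1) + var 2 * const (z 2)"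
    by simp
  with assms(2) consider "z 0 \<noteq> 0" | "z 1 \<noteq> 0" | "z 2 \<noteq> 0" by fastforce
  then show thesis
  proof cases
    case 1
    then have "line l 0 1 2 (z 0) (z 1) (z 2)"
      by unfold_locales (use l assms(2) in \<open>auto simp: algebra_simps\<close>)
    then show thesis by (rule that)
  next
    case 2
    then have "line l 1 0 2 (z 1) (z 0) (z 2)"
      by unfold_locales (use l assms(2) in \<open>auto simp: algebra_simps\<close>)
    then show thesis by (rule that)
  next
    case 3
    then have "line l 2 0 1 (z 2) (z 0) (z 1)"
      by unfold_locales (use l assms(2) in \<open>auto simp: algebra_simps\<close>)
    then show thesis by (rule that)
  qed
qed

subsection \<open>Jacobian syzygies\<close>

definition smul :: "mpoly \<Rightarrow> triple \<Rightarrow> triple" where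
  "smul p v = (p * fst v, p * fst (snd v), p * snd (snd v))"

lemma smul_simps: "smul p (a, b, c) = (p * a, p * b, p * c)"
  by (simp add: smul_def)

lemma smul_add_right: "smul p (u + v) = smul p u + smul p v"
  and smul_add_left: "smul (p + q) u = smul p u + smul q u"
  and smul_diff_right: "smul p (u - v) = smul p u - smul p v"
  and smul_smul: "smul p (smul q u) = smul (p * q) u"
  by (simp_all add: smul_def algebra_simps)

lemma smul_0_left [simp]: "smul 0 v = 0" and smul_1 [simp]: "smul 1 v = v"
  and smul_0_right [simp]: "smul p 0 = 0"
  by (simp_all add: smul_def zero_prod_def)

lemma smul_sum_left: "smul (sum h I) v = (\<Sum>i\<in>I. smul (h i) v)"
  by (induction I rule: infinite_finite_induct) (simp_all add: smul_add_left)

lemma lin_comb_eq: "lin_comb hs gs = (\<Sum>i<length gs. smul (hs ! i) (gs ! i))"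
  by (simp add: lin_comb_def smul_def sum_prod)

definition cross :: "triple \<Rightarrow> triple \<Rightarrow> triple" where
  "cross u v = (case u of (a, b, c) \<Rightarrow> case v of (a', b', c') \<Rightarrow>
     (b * c' - c * b', c * a' - a * c', a * b' - b * a'))"

definition act :: "triple \<Rightarrow> mpoly \<Rightarrow> mpoly" where
  "act v p = fst v * pdiff 0 p + fst (snd v) * pdiff 1 p + snd (snd v) * pdiff 2 p"

definition in_S3 :: "triple \<Rightarrow> bool" where
  "in_S3 v \<longleftrightarrow> in_S (fst v) \<and> in_S (fst (snd v)) \<and> in_S (snd (snd v))"

lemma act_add: "act (u + v) p = act u p + act v p"
  and act_diff: "act (u - v) p = act u p - act v p"
  and act_smul: "act (smul q v) p = q * act v p"
  by (simp_all add: act_def smul_def algebra_simps)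

lemma act_mult: "act v (p * q) = p * act v q + q * act v p"
  by (simp add: act_def pdiff_mult algebra_simps)

lemma in_S_act: "in_S3 v \<Longrightarrow> in_S p \<Longrightarrow> in_S (act v p)"
  by (simp add: act_def in_S3_def)

lemma in_S3_add: "in_S3 u \<Longrightarrow> in_S3 v \<Longrightarrow> in_S3 (u + v)"
  and in_S3_diff: "in_S3 u \<Longrightarrow> in_S3 v \<Longrightarrow> in_S3 (u - v)"
  and in_S3_smul: "in_S p \<Longrightarrow> in_S3 v \<Longrightarrow> in_S3 (smul p v)"
  by (simp_all add: in_S3_def smul_def)

lemma D0_iff_act: "v \<in> D0 f \<longleftrightarrow> in_S3 v \<and> act v f = 0"
  by (cases v) (simp add: D0_def in_S3_def act_def)

lemma D0_iff: "(a, b, c) \<in> D0 f \<longleftrightarrow> in_S a \<and> in_S b \<and> in_S c \<and>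
    a * pdiff 0 f + b * pdiff 1 f + c * pdiff 2 f = 0"
  by (simp add: D0_def)

lemma D0_add: "u \<in> D0 f \<Longrightarrow> v \<in> D0 f \<Longrightarrow> u + v \<in> D0 f"
  and D0_smul: "in_S p \<Longrightarrow> u \<in> D0 f \<Longrightarrow> smul p u \<in> D0 f"
  by (simp_all add: D0_iff_act act_add act_smul in_S3_add in_S3_smul)

lemma koszul_in_D0:
  assumes "in_S f"
  shows "(pdiff 1 f, - pdiff 0 f, 0) \<in> D0 f" "(pdiff 2 f, 0, - pdiff 0 f) \<in> D0 f"
    "(0, pdiff 2 f, - pdiff 1 f) \<in> D0 f"
  using assms by (simp_all add: D0_iff mult.commute)

text \<open>Syzygies are orthogonal to the gradient, so the cross product of two of them is parallel
  to it; here the factors are explicit.\<close>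

lemma cross_koszul:
  "cross (g1, - g0, 0) (g2, 0, - g0) = smul g0 (g0, g1, g2)"
  "cross (g1, - g0, 0) (0, g2, - g1) = smul g1 (g0, g1, g2)"
  "cross (g2, 0, - g0) (0, g2, - g1) = smul g2 (g0, g1, g2)"
  by (simp_all add: cross_def smul_def algebra_simps)

lemma cross_lin_comb:
  "cross (smul p u + smul q v) (smul r u + smul s v) = smul (p * s - q * r) (cross u v)"
  by (cases u; cases v) (simp add: cross_def smul_simps algebra_simps)

lemma pdiff_nonzero:
  assumes "homog (Suc d) f" "f \<noteq> 0"
  obtains i where "i < 3" "pdiff i f \<noteq> 0"
proof -
  have "\<exists>i<3. pdiff i f \<noteq> 0"
  proof (rule ccontr)
    assume "\<not> ?thesis"
    then have "pdiff 0 f = 0" "pdiff 1 f = 0" "pdiff 2 f = 0" by auto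
    with euler[OF assms(1)] assms(2) show False by (simp del: of_nat_Suc)
  qed
  with that show thesis by blast
qed

text \<open>With at most one generator all cross products of syzygies vanish; those of the Koszul
  syzygies contain the squares of the partial derivatives, which would all be zero.\<close>

lemma hom_gen_system_length_ge_2:
  assumes f: "homog (Suc d) f" "f \<noteq> 0" and gs: "hom_gen_system f gs ds"
  shows "length gs \<ge> 2"
proof (rule ccontr)
  assume "\<not> ?thesis"
  then have len: "length gs = 0 \<or> length gs = 1" by linarith
  obtain g where g: "\<exists>h. v = smul h g" if "v \<in> D0 f" for v
  proof (cases "length gs = 0")
    case True
    then have "\<exists>h. v = smul h 0" if "v \<in> D0 f" for v
      using gs that by (auto simp: hom_gen_system_def lin_comb_eq)
    with that show thesis by blast
  next
    case False
    with len have "length gs = 1" by simp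
    then have "\<exists>h. v = smul h (gs ! 0)" if "v \<in> D0 f" for v
      using gs that by (auto simp: hom_gen_system_def lin_comb_eq)
    with that show thesis by blast
  qed
  have cr: "cross u v = 0" if "u \<in> D0 f" "v \<in> D0 f" for u v
  proof -
    from g that obtain p q where "u = smul p g" "v = smul q g" by blast
    then show ?thesis using cross_lin_comb[of p g 0 0 q 0] by simp
  qed
  note k = koszul_in_D0[OF homog_in_S[OF f(1)]]
  have "pdiff 0 f = 0" "pdiff 1 f = 0" "pdiff 2 f = 0"
    using cr[OF k(1,2)] cr[OF k(1,3)] cr[OF k(2,3)]
    unfolding cross_koszul by (simp_all add: smul_def zero_prod_def)
  moreover obtain i where "i < 3" "pdiff i f \<noteq> 0" using pdiff_nonzero[OF f] .
  ultimately show False by (auto simp: less_Suc_eq numeral_3_eq_3 numeral_2_eq_2)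
qed

text \<open>Contracting with the Euler field would make the degree d + 1 form f divide a form of smaller
degree.\<close>

lemma parallel_gradient_0:
  assumes red: "reduced f" and f: "homog (Suc d) f" and kd: "k < d"
    and u: "\<And>i. i < 3 \<Longrightarrow> homog k (u i)"
    and par: "\<And>i j. i < 3 \<Longrightarrow> j < 3 \<Longrightarrow> pdiff i f * u j = pdiff j f * u i"
    and i: "i < 3"
  shows "u i = 0"
proof -
  define U where "U = var 0 * u 0 + var 1 * u 1 + var 2 * u 2"
  have fnz: "f \<noteq> 0" "in_S f" using red by (auto simp: reduced_def)
  have hU: "homog (1 + k) U"
    unfolding U_def by (intro homog_add homog_mult homog_var u) auto
  have eq: "U * pdiff i f = const (of_nat (Suc d)) * f * u i" if "i < 3" for i
  proof -
    have "U * pdiff i f = var 0 * (pdiff i f * u 0) + var 1 * (pdiff i f * u 1) + var 2 * (pdiff i f * u 2)"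
      by (simp add: U_def algebra_simps)
    also have "\<dots> = (var 0 * pdiff 0 f + var 1 * pdiff 1 f + var 2 * pdiff 2 f) * u i"
      using that by (simp add: par[of i] distrib_right mult.assoc)
    finally show ?thesis using euler[OF f] by simp
  qed
  have "f dvd U * pdiff i f" if "i < 3" for i
    using eq[OF that] by simp
  then have "f dvd U" using reduced_dvd[OF red] homog_in_S[OF hU] by blast
  then obtain r where r: "in_S r" "U = f * r" using in_S_dvdE[OF fnz(2) homog_in_S[OF hU]] by blast
  \<comment> \<open>U has degree k + 1 < d + 1, too small for a nonzero multiple of f.\<close>
  have "U = 0"
    using homog_cofactor[OF f fnz(1) r(1), of "1 + k"] hU kd by (cases "r = 0") (auto simp: r)
  with eq[OF i] fnz show ?thesis by (simp del: of_nat_Suc)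
qed

definition comp :: "triple \<Rightarrow> nat \<Rightarrow> mpoly" where
  "comp v i = (if i = 0 then fst v else if i = 1 then fst (snd v) else snd (snd v))"

lemma comp_smul: "comp (smul p v) i = p * comp v i"
  by (simp add: comp_def smul_def)

text \<open>Expressing the Koszul syzygies through the generators shows that their cross product is the
gradient up to a factor; since f is reduced, the factor is a constant.\<close>

lemma free_degree_sum:
  assumes red: "reduced f" and f: "homog (Suc d) f" and d: "d > 0"
    and r1: "homog_triple e1 r1" and r2: "homog_triple e2 r2"
    and gen: "\<And>v. v \<in> D0 f \<Longrightarrow> \<exists>p q. in_S p \<and> in_S q \<and> v = smul p r1 + smul q r2"
  shows "e1 + e2 = d"
proof -
  have fnz: "f \<noteq> 0" "in_S f" using red by (auto simp: reduced_def)
  define nu where "nu = comp (cross r1 r2)"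
  have hnu: "homog (e1 + e2) (nu i)" for i
    using r1 r2 unfolding nu_def comp_def cross_def homog_triple_def
    by (auto split: prod.splits)
  \<comment> \<open>Two Koszul syzygies have cross product f_i times the gradient; e is the
    determinant of their coefficients in r1, r2.\<close>
  have "\<exists>e. in_S e \<and> (\<forall>j<3. e * nu j = pdiff i f * pdiff j f)" if i: "i < 3" for i
  proof -
    obtain u v where uv: "u \<in> D0 f" "v \<in> D0 f"
      and cr: "cross u v = smul (pdiff i f) (pdiff 0 f, pdiff 1 f, pdiff 2 f)"
    proof -
      consider "i = 0" | "i = 1" | "i = 2" using i by linarith
      then show thesis
        using that koszul_in_D0[OF fnz(2)] cross_koszul(1,2)[of "pdiff 1 f" "pdiff 0 f" "pdiff 2 f"]
          cross_koszul(3)[of "pdiff 2 f" "pdiff 0 f" "pdiff 1 f"]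
        by cases metis+
    qed
    from gen[OF uv(1)] gen[OF uv(2)] obtain p q p' q' where
      pq: "in_S p" "in_S q" "u = smul p r1 + smul q r2" "in_S p'" "in_S q'" "v = smul p' r1 + smul q' r2"
      by metis
    have "smul (p * q' - q * p') (cross r1 r2) = smul (pdiff i f) (pdiff 0 f, pdiff 1 f, pdiff 2 f)"
      using cr unfolding pq cross_lin_comb .
    then have "(p * q' - q * p') * nu j = pdiff i f * comp (pdiff 0 f, pdiff 1 f, pdiff 2 f) j" for j
      unfolding nu_def by (metis comp_smul)
    moreover have "comp (pdiff 0 f, pdiff 1 f, pdiff 2 f) j = pdiff j f" if j: "j < 3" for j
    proof -
      consider "j = 0" | "j = 1" | "j = 2" using j by linarith
      then show ?thesis by cases (simp_all add: comp_def)
    qed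
    ultimately show ?thesis using pq by (intro exI[of _ "p * q' - q * p'"]) auto
  qed
  then obtain de where "\<forall>i<3. in_S (de i) \<and> (\<forall>j<3. de i * nu j = pdiff i f * pdiff j f)"
    by metis
  then have de: "in_S (de i)" "\<And>j. j < 3 \<Longrightarrow> de i * nu j = pdiff i f * pdiff j f" if "i < 3" for i
    using that by auto
  obtain m where m: "m < 3" "pdiff m f \<noteq> 0" using pdiff_nonzero[OF f fnz(1)] .
  then have nz: "de m \<noteq> 0" "nu m \<noteq> 0" using de(2)[OF m(1) m(1)] by auto
  \<comment> \<open>In \<open>de i * nu j = pdiff i f * pdiff j f\<close> the two families play
    symmetric roles, so both are parallel to the gradient. Their degrees add up to 2d, so if e1 + e2
    differs from d, one of them falls below d and must vanish.\<close>
  have "\<not> e1 + e2 < d"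
  proof
    assume lt: "e1 + e2 < d"
    have par: "pdiff i f * nu j = pdiff j f * nu i" if "i < 3" "j < 3" for i j
    proof -
      have "de m * (pdiff i f * nu j) = de m * (pdiff j f * nu i)"
        using de(2)[OF m(1) that(1)] de(2)[OF m(1) that(2)] by algebra
      with nz show ?thesis by simp
    qed
    show False using parallel_gradient_0[OF red f lt hnu par m(1)] nz by simp
  qed
  \<comment> \<open>Now the small family is \<open>de\<close>, of degree 2d - (e1 + e2) < d.\<close>
  moreover have "\<not> d < e1 + e2"
  proof
    assume lt: "d < e1 + e2"
    have hg: "homog d (pdiff i f)" for i using f by (rule homog_pdiff)
    have hd: "de i = 0 \<or> e1 + e2 \<le> d + d \<and> homog (d + d - (e1 + e2)) (de i)" if "i < 3" for i
    proof -
      have "homog (d + d) (nu m * de i)"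
        using de(2)[OF that m(1)] homog_mult[OF hg hg] by (simp add: mult.commute)
      with homog_cofactor[OF hnu nz(2) de(1)[OF that]] show ?thesis by blast
    qed
    have "e1 + e2 \<le> d + d" using hd[OF m(1)] nz by blast
    with lt have lt': "d + d - (e1 + e2) < d" by simp
    have par: "pdiff i f * de j = pdiff j f * de i" if "i < 3" "j < 3" for i j
    proof -
      have "nu m * (pdiff i f * de j) = nu m * (pdiff j f * de i)"
        using de(2)[OF that(1) m(1)] de(2)[OF that(2) m(1)] by algebra
      with nz show ?thesis by simp
    qed
    have "homog (d + d - (e1 + e2)) (de i)" if "i < 3" for i using hd[OF that] by auto
    from parallel_gradient_0[OF red f lt' this par m(1)] nz show False by simp
  qed
  ultimately show ?thesis by simp
qed

section \<open>Homogeneous triples and their components\<close>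

lemma triple_eqI: "fst u = fst v \<Longrightarrow> fst (snd u) = fst (snd v) \<Longrightarrow> snd (snd u) = snd (snd v) \<Longrightarrow> u = (v :: triple)"
  by (simp add: prod_eq_iff)

lemma homog_triple_iff: "homog_triple n v \<longleftrightarrow> homog n (fst v) \<and> homog n (fst (snd v)) \<and> homog n (snd (snd v))"
  by (cases v) (simp add: homog_triple_def)

lemma homog_triple_in_S3: "homog_triple n v \<Longrightarrow> in_S3 v"
  by (auto simp: homog_triple_iff in_S3_def dest: homog_in_S)

lemma homog_triple_add: "homog_triple n u \<Longrightarrow> homog_triple n v \<Longrightarrow> homog_triple n (u + v)"
  and homog_triple_smul: "homog m p \<Longrightarrow> homog_triple n v \<Longrightarrow> homog_triple (m + n) (smul p v)"
  by (auto simp: homog_triple_iff smul_def)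

lemma smul_cancel: "p \<noteq> 0 \<Longrightarrow> smul p u = smul p v \<Longrightarrow> u = v"
  by (simp add: smul_def prod_eq_iff)

definition hc3 :: "nat \<Rightarrow> triple \<Rightarrow> triple" where
  "hc3 n v = (hc n (fst v), hc n (fst (snd v)), hc n (snd (snd v)))"

lemma homog_triple_hc3: "in_S3 v \<Longrightarrow> homog_triple n (hc3 n v)"
  by (simp add: homog_triple_iff hc3_def in_S3_def homog_hc)

lemma hc3_add: "hc3 n (u + v) = hc3 n u + hc3 n v"
  by (simp add: hc3_def hc_add)

lemma hc3_homog: "homog_triple n v \<Longrightarrow> hc3 n v = v"
  by (simp add: hc3_def homog_triple_iff hc_homog[of n _ n])

lemma sum_hc_le: "degree (hp p) \<le> n \<Longrightarrow> (\<Sum>k\<le>n. hc k p) = p"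
  using sum_hc[of p] sum.mono_neutral_left[of "{..n}" "{..degree (hp p)}" "\<lambda>k. hc k p"]
  by (simp add: hc_def coeff_eq_0)

lemma sum_hc3:
  obtains n where "(\<Sum>k\<le>n. hc3 k v) = v"
proof
  let ?n = "degree (hp (fst v)) + degree (hp (fst (snd v))) + degree (hp (snd (snd v)))"
  show "(\<Sum>k\<le>?n. hc3 k v) = v"
    by (rule triple_eqI) (simp_all add: fst_sum snd_sum hc3_def sum_hc_le)
qed

lemma D0_hc3:
  assumes "homog (Suc d) f" "v \<in> D0 f"
  shows "hc3 n v \<in> D0 f"
proof -
  have *: "hc n a * pdiff i f = hc (d + n) (a * pdiff i f)" for a i
    using hc_mult[OF homog_pdiff[OF assms(1)], of "d + n" i a] by (simp add: mult.commute)
  have "act (hc3 n v) f = hc (d + n) (act v f)"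
    by (simp add: act_def hc3_def * hc_add)
  with assms(2) homog_triple_hc3[of v n] show ?thesis
    by (simp add: D0_iff_act homog_triple_in_S3)
qed

text \<open>Homogeneous of degree n - e, with n - e taken in the integers: multiplication by such a
polynomial sends forms of degree e to forms of degree n.\<close>

definition shom :: "nat \<Rightarrow> nat \<Rightarrow> mpoly \<Rightarrow> bool" where
  "shom e n p \<longleftrightarrow> p = 0 \<or> e \<le> n \<and> homog (n - e) p"

lemma shom_in_S: "shom e n p \<Longrightarrow> in_S p"
  by (auto simp: shom_def homog_in_S)

lemma shom_diff: "shom e n p \<Longrightarrow> shom e n q \<Longrightarrow> shom e n (p - q)"
  unfolding shom_def using homog_diff homog_uminus by fastforce

lemma shom_mult:
  assumes "homog m p" "shom e n q"
  shows "shom e (m + n) (p * q)"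
  using assms homog_mult[of m p "n - e" q] by (auto simp: shom_def)

lemma shom_smul: "shom e n p \<Longrightarrow> homog_triple e v \<Longrightarrow> homog_triple n (smul p v)"
  using homog_triple_smul[of "n - e" p e v] by (auto simp: shom_def homog_triple_iff)

lemma hc3_smul:
  assumes "in_S p" "homog_triple e v"
  obtains q where "shom e n q" "hc3 n (smul p v) = smul q v"
proof
  let ?q = "if e \<le> n then hc (n - e) p else 0"
  show "shom e n ?q" using assms(1) by (simp add: shom_def homog_hc)
  have "hc n (p * a) = ?q * a" if "homog e a" for a
    using hc_mult[OF that, of n p] by (simp add: mult.commute)
  then show "hc3 n (smul p v) = smul ?q v"
    using assms(2) by (simp add: hc3_def smul_def homog_triple_iff)
qed

lemma gen_homog:
  assumes "v = smul p t1 + smul q t2" "in_S p" "in_S q"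
    and "homog_triple e1 t1" "homog_triple e2 t2" "homog_triple n v"
  obtains a b where "shom e1 n a" "shom e2 n b" "v = smul a t1 + smul b t2"
proof -
  obtain a where a: "shom e1 n a" "hc3 n (smul p t1) = smul a t1" using hc3_smul[OF assms(2,4)] .
  obtain b where b: "shom e2 n b" "hc3 n (smul q t2) = smul b t2" using hc3_smul[OF assms(3,5)] .
  have "v = hc3 n (smul p t1 + smul q t2)" using hc3_homog[OF assms(6)] assms(1) by simp
  with a b that show thesis by (simp add: hc3_add)
qed

subsection \<open>Deletion of a line\<close>

definition eul :: triple where "eul = (var 0, var 1, var 2)"

lemma act_eul: "homog k p \<Longrightarrow> act eul p = const (of_nat k) * p"
  using euler by (simp add: act_def eul_def)

lemma homog_eul: "homog_triple 1 eul"
  using homog_var[of 0] homog_var[of 1] homog_var[of 2] by (simp add: homog_triple_iff eul_def)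

text \<open>With the degree of f written as a successor, the partial derivatives are forms of degree
  d and the factor in Euler's formula is nonzero.\<close>

locale deletion = line +
  fixes f :: mpoly and d :: nat
  assumes f: "homog (Suc d) f" and l_not_dvd: "\<not> l dvd f"
begin

lemma f_nonzero: "f \<noteq> 0"
  using l_not_dvd by auto

lemma T_f: "T f \<noteq> 0"
  using dvd_homog_iff[OF f] l_not_dvd by simp

lemma act_l_homog: "homog_triple n v \<Longrightarrow> homog n (act v l)"
proof -
  assume v: "homog_triple n v"
  have "homog 0 (pdiff m l)" for m using homog_pdiff[of 0 l m] homog_l by simp
  with v homog_mult[of n _ 0] show "homog n (act v l)"
    unfolding act_def homog_triple_iff by (metis homog_add add_0_right)
qed

definition N :: "triple set" where "N = {v \<in> D0 f. l dvd act v l}"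

lemma N_add: "u \<in> N \<Longrightarrow> v \<in> N \<Longrightarrow> u + v \<in> N"
  and N_smul: "in_S p \<Longrightarrow> u \<in> N \<Longrightarrow> smul p u \<in> N"
  by (simp_all add: N_def D0_add D0_smul act_add act_smul)

lemma N_sum: "(\<And>i. i \<in> I \<Longrightarrow> h i \<in> N) \<Longrightarrow> sum h I \<in> N"
proof (induction I rule: infinite_finite_induct)
  case (insert x F)
  then show ?case by (simp add: N_add)
qed (simp_all add: N_def D0_iff_act in_S3_def act_def)

text \<open>From r(f l) = 0, restriction to the line gives r(l) = l s, hence r(f) = -f s. A multiple
  of the Euler field then cancels r(f) and keeps r(l) divisible by l.\<close>

lemma D0_mult_to_N:
  assumes r: "r \<in> D0 (f * l)" "homog_triple e r"
  obtains t q where "t \<in> N" "homog_triple e t" "in_S q" "t = r + smul q eul"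
proof -
  have eq: "f * act r l + l * act r f = 0" using r(1) by (simp add: D0_iff_act act_mult)
  have "T (f * act r l + l * act r f) = 0" unfolding eq by simp
  then have "T (act r l) = 0" using T_f by (simp add: T.ev_add T.ev_mult)
  then have "l dvd act r l" using dvd_homog_iff[OF act_l_homog[OF r(2)]] by simp
  moreover have "in_S (act r l)" using act_l_homog[OF r(2)] by (rule homog_in_S)
  ultimately obtain s where s: "in_S s" "act r l = l * s" using in_S_dvdE[OF in_S_l] by blast
  have "l * (act r f + f * s) = 0" using eq by (simp add: s algebra_simps)
  then have arf: "act r f = - (f * s)" using l_nonzero by (simp add: add_eq_0_iff)
  \<comment> \<open>The Euler field multiplies f by c = deg f, so s/c is the correcting
    factor.\<close>
  define c where "c = (of_nat (Suc d) :: complex)"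
  have c: "const c * const (1 / c) = 1" by (simp add: c_def del: of_nat_Suc flip: const_mult)
  define q where "q = const (1 / c) * s"
  have hq: "homog_triple e (smul q eul)"
  proof (cases "s = 0")
    case False
    have "1 \<le> e \<and> homog (e - 1) s"
      using homog_cofactor[OF homog_l l_nonzero s(1) _ False, of e] act_l_homog[OF r(2)] s(2) by simp
    then have "homog (e - 1) q" "e - 1 + 1 = e" by (simp_all add: q_def homog_const_mult)
    then show ?thesis using homog_triple_smul[OF _ homog_eul] by metis
  qed (simp add: q_def homog_triple_iff)
  show thesis
  proof
    show "homog_triple e (r + smul q eul)" using r(2) hq by (rule homog_triple_add)
    show "in_S q" using s by (simp add: q_def)
    have "act (r + smul q eul) f = - (f * s) + const c * const (1 / c) * (f * s)"
      by (simp add: act_add act_smul act_eul[OF f] arf q_def c_def mult_ac del: of_nat_Suc)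
    then have "act (r + smul q eul) f = 0" by (simp add: c)
    moreover have "act (r + smul q eul) l = l * (s + q)"
      by (simp add: act_add act_smul act_eul[OF homog_l] s(2) algebra_simps)
    moreover have "in_S3 (r + smul q eul)"
      using r hq by (intro in_S3_add homog_triple_in_S3)
    ultimately show "r + smul q eul \<in> N" by (simp add: N_def D0_iff_act)
  qed simp
qed

text \<open>The reverse correction: v(f l) = f l s with v(l) = l s, so the divisor is now d + 2, the
  degree of f l.\<close>

lemma N_to_D0_mult:
  assumes "v \<in> N"
  obtains q where "in_S q" "v - smul q eul \<in> D0 (f * l)"
proof -
  have v: "in_S3 v" "act v f = 0" "l dvd act v l" using assms by (auto simp: N_def D0_iff_act)
  then obtain s where s: "in_S s" "act v l = l * s"
    using in_S_dvdE[OF in_S_l in_S_act[OF v(1) in_S_l]] by blast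
  define c where "c = (of_nat (Suc d + 1) :: complex)"
  have c: "const c * const (1 / c) = 1" unfolding c_def by (simp del: of_nat_Suc flip: const_mult)
  define q where "q = const (1 / c) * s"
  have "act eul (f * l) = const c * (f * l)"
    using act_eul[OF homog_mult[OF f homog_l]] by (simp add: c_def)
  then have "act (v - smul q eul) (f * l) = f * l * s - const c * const (1 / c) * (f * l * s)"
    by (simp add: act_diff act_smul act_mult[of v] v s(2) q_def mult_ac)
  then have "act (v - smul q eul) (f * l) = 0" by (simp add: c)
  moreover have "in_S q" using s by (simp add: q_def)
  ultimately show thesis
    using that[of q] v(1) homog_triple_in_S3[OF homog_eul] by (simp add: D0_iff_act in_S3_diff in_S3_smul)
qed

text \<open>The cross product of the gradients of l and f is a syzygy of both.\<close>

lemma N_not_divisible: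
  obtains v where "v \<in> N" "\<not> (T (fst v) = 0 \<and> T (fst (snd v)) = 0 \<and> T (snd (snd v)) = 0)"
proof (rule ccontr)
  assume "\<not> thesis"
  with that have H: "T (fst v) = 0 \<and> T (fst (snd v)) = 0 \<and> T (snd (snd v)) = 0" if "v \<in> N" for v
    using that by blast
  let ?v = "cross (pdiff 0 l, pdiff 1 l, pdiff 2 l) (pdiff 0 f, pdiff 1 f, pdiff 2 f)"
  have "in_S3 ?v" using homog_in_S[OF f] by (simp add: in_S3_def cross_def)
  moreover have "act ?v f = 0" "act ?v l = 0" by (simp_all add: act_def cross_def algebra_simps)
  ultimately have "?v \<in> N" by (simp add: N_def D0_iff_act)
  \<comment> \<open>The two gradients would be parallel along the line. Contracting with the
    position vector gives 0 for l but (d + 1) f, nonzero on the line, for f; this forces the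
    constant gradient of l to vanish.\<close>
  from H[OF this] have
    "T (pdiff 1 l) * T (pdiff 2 f) = T (pdiff 2 l) * T (pdiff 1 f)"
    "T (pdiff 2 l) * T (pdiff 0 f) = T (pdiff 0 l) * T (pdiff 2 f)"
    "T (pdiff 0 l) * T (pdiff 1 f) = T (pdiff 1 l) * T (pdiff 0 f)"
    by (simp_all add: cross_def T.ev_diff T.ev_mult)
  moreover have "T (var 0) * T (pdiff 0 l) + T (var 1) * T (pdiff 1 l) + T (var 2) * T (pdiff 2 l) = 0"
    using arg_cong[OF euler[OF homog_l], of T] by (simp add: T.ev_add T.ev_mult)
  moreover have "T (var 0) * T (pdiff 0 f) + T (var 1) * T (pdiff 1 f) + T (var 2) * T (pdiff 2 f) \<noteq> 0"
    using arg_cong[OF euler[OF f], of T] T_f by (simp add: T.ev_add T.ev_mult del: of_nat_Suc)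
  ultimately have z: "T (pdiff 0 l) = 0" "T (pdiff 1 l) = 0" "T (pdiff 2 l) = 0"
    by algebra+
  obtain m where m: "m < 3" "pdiff m l \<noteq> 0" using pdiff_nonzero[of 0 l] homog_l l_nonzero by auto
  have "homog 0 (pdiff m l)" using homog_pdiff[of 0 l m] homog_l by simp
  then obtain z where z': "pdiff m l = const z" using homog_0_const by blast
  with m have "T (pdiff m l) \<noteq> 0" by auto
  moreover have "m = 0 \<or> m = 1 \<or> m = 2" using m by linarith
  ultimately show False using z by auto
qed

end

section \<open>Generating pairs and freeness\<close>

lemma hom_gen_system_2_gen:
  assumes "hom_gen_system f [g1, g2] ds" "v \<in> D0 f"
  shows "\<exists>p q. in_S p \<and> in_S q \<and> v = smul p g1 + smul q g2"
proof -
  obtain hs where hs: "length hs = 2" "\<forall>h\<in>set hs. in_S h" "v = lin_comb hs [g1, g2]"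
    using assms by (auto simp: hom_gen_system_def numeral_2_eq_2)
  then obtain p q where "hs = [p, q]" by (auto simp: numeral_2_eq_2 length_Suc_conv)
  with hs show ?thesis by (auto simp: lin_comb_eq)
qed

text \<open>Any generating pair is minimal by the lower bound of two; it is swapped if necessary
  because exponents are sorted.\<close>

lemma free_curve_if_two_generators:
  assumes f: "homog (Suc d) f" "f \<noteq> 0"
    and g: "g1 \<in> D0 f" "g2 \<in> D0 f" "homog_triple d1 g1" "homog_triple d2 g2"
    and gen: "\<And>v. v \<in> D0 f \<Longrightarrow> \<exists>p q. in_S p \<and> in_S q \<and> v = smul p g1 + smul q g2"
  shows "free_curve f"
proof -
  have *: "free_curve f" if "d1 \<le> d2" "g1 \<in> D0 f" "g2 \<in> D0 f" "homog_triple d1 g1" "homog_triple d2 g2"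
    "\<And>v. v \<in> D0 f \<Longrightarrow> \<exists>p q. in_S p \<and> in_S q \<and> v = smul p g1 + smul q g2" for d1 d2 g1 g2
  proof -
    have "hom_gen_system f [g1, g2] [d1, d2]"
      unfolding hom_gen_system_def
    proof (intro conjI ballI)
      fix v assume "v \<in> D0 f"
      with that(6) obtain p q where "in_S p" "in_S q" "v = smul p g1 + smul q g2" by blast
      then show "\<exists>hs. length hs = length [g1, g2] \<and> (\<forall>h\<in>set hs. in_S h) \<and> v = lin_comb hs [g1, g2]"
        by (intro exI[of _ "[p, q]"]) (simp add: lin_comb_eq)
    qed (use that in \<open>auto simp: less_Suc_eq\<close>)
    then have "min_hom_gen_system f [g1, g2] [d1, d2]"
      using hom_gen_system_length_ge_2[OF f] by (simp add: min_hom_gen_system_def numeral_2_eq_2)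
    with that(1) have "exponents f [d1, d2]" by (auto simp: exponents_def)
    then show ?thesis unfolding free_curve_def by (rule_tac exI[of _ "[d1, d2]"]) simp
  qed
  show ?thesis
  proof (cases "d1 \<le> d2")
    case True
    then show ?thesis using g gen by (intro *[of d1 d2 g1 g2]) auto
  next
    case False
    have "\<exists>p q. in_S p \<and> in_S q \<and> v = smul p g2 + smul q g1" if "v \<in> D0 f" for v
      using gen[OF that] by (metis add.commute)
    with False show ?thesis using g by (intro *[of d2 d1 g2 g1]) auto
  qed
qed

text \<open>The assumptions are symmetric in t1 and t2, so the locale can be interpreted again with
  the two exchanged.\<close>

locale free_addition = deletion +
  fixes t1 t2 :: triple and e1 e2 :: nat
  assumes t: "t1 \<in> N" "t2 \<in> N" and homog_t: "homog_triple e1 t1" "homog_triple e2 t2"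
    and N_gen: "\<And>v. v \<in> N \<Longrightarrow> \<exists>p q. in_S p \<and> in_S q \<and> v = smul p t1 + smul q t2"
begin

lemma N_lin_comb: "in_S p \<Longrightarrow> in_S q \<Longrightarrow> smul p t1 + smul q t2 \<in> N"
  using t by (intro N_add N_smul)

lemma smul_l_N: "v \<in> D0 f \<Longrightarrow> smul l v \<in> N"
  by (simp add: N_def D0_smul act_smul)

text \<open>Over the ring of the line, the syzygies of f modulo N have rank one.\<close>

lemma rank_one:
  assumes w: "smul l w = smul a t1 + smul b t2" and m: "smul l m = smul a' t1 + smul b' t2"
  shows "T a * T b' = T a' * T b"
proof (rule ccontr)
  assume ne: "\<not> ?thesis"
  define de where "de = a * b' - a' * b"
  have T_de: "T de \<noteq> 0" using ne by (simp add: de_def T.ev_diff T.ev_mult)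
  \<comment> \<open>Cramer's rule: both \<open>smul de t1\<close> and \<open>smul de t2\<close> are
    multiples of l, while \<open>de\<close> does not vanish on the line. So t1 and t2, and with them
    all of N, would vanish there.\<close>
  have "smul de t1 = smul b' (smul a t1 + smul b t2) - smul b (smul a' t1 + smul b' t2)"
    "smul de t2 = smul a (smul a' t1 + smul b' t2) - smul a' (smul a t1 + smul b t2)"
    by (rule triple_eqI; simp add: de_def smul_def algebra_simps)+
  then have eq: "smul de t1 = smul l (smul b' w - smul b m)" "smul de t2 = smul l (smul a m - smul a' w)"
    unfolding w[symmetric] m[symmetric]
    by (simp_all add: smul_diff_right smul_smul mult.commute)
  have cancel: "T y = 0" if "de * y = l * x" for x y
    using arg_cong[OF that, of T] T_de by (simp add: T.ev_mult)
  have 0: "T (fst t1) = 0" "T (fst (snd t1)) = 0" "T (snd (snd t1)) = 0"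
    "T (fst t2) = 0" "T (fst (snd t2)) = 0" "T (snd (snd t2)) = 0"
    using eq unfolding smul_def prod_eq_iff fst_conv snd_conv by (blast intro: cancel)+
  obtain v where v: "v \<in> N" "\<not> (T (fst v) = 0 \<and> T (fst (snd v)) = 0 \<and> T (snd (snd v)) = 0)"
    by (rule N_not_divisible)
  from N_gen[OF v(1)] obtain p q where "v = smul p t1 + smul q t2" by blast
  with v(2) 0 show False by (simp add: smul_def T.ev_add T.ev_mult)
qed

text \<open>The image of \<open>shom e n\<close> under \<open>T\<close>: in the affine chart, forms
  of degree n - e become polynomials of at most that degree.\<close>

definition bounded :: "nat \<Rightarrow> nat \<Rightarrow> complex poly \<Rightarrow> bool" where
  "bounded e n q \<longleftrightarrow> q = 0 \<or> e + degree q \<le> n"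

lemma bounded_T: "shom e n p \<Longrightarrow> bounded e n (T p)"
  using degree_T[of "n - e" p] by (auto simp: shom_def bounded_def)

lemma bounded_lift:
  assumes "bounded e n q"
  obtains p where "shom e n p" "T p = q"
proof (cases "q = 0")
  case True
  with that[of 0] show thesis by (simp add: shom_def)
next
  case False
  with assms that[of "lift (n - e) q"] show thesis by (auto simp: shom_def bounded_def T_lift)
qed

lemma shom_dvd: "shom e n p \<Longrightarrow> T p = 0 \<Longrightarrow> \<exists>r. in_S r \<and> p = l * r"
proof -
  assume p: "shom e n p" "T p = 0"
  then have "l dvd p" using dvd_homog_iff by (auto simp: shom_def)
  then show ?thesis using in_S_dvdE[OF in_S_l shom_in_S[OF p(1)]] by blast
qed

text \<open>The coordinates are divisible by l one by one, and l cancels from the syzygy relation.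
  The clause for n = 0 makes up for the truncated n - 1.\<close>

lemma divide_by_l:
  assumes v: "v \<in> D0 f" "homog_triple n v"
    and "T (fst v) = 0" "T (fst (snd v)) = 0" "T (snd (snd v)) = 0"
  obtains u where "u \<in> D0 f" "homog_triple (n - 1) u" "v = smul l u" "n = 0 \<Longrightarrow> u = 0"
proof -
  have *: "\<exists>q. p = l * q \<and> homog (n - 1) q \<and> (n = 0 \<longrightarrow> q = 0)" if p: "homog n p" "T p = 0" for p
  proof -
    have "l dvd p" using dvd_homog_iff p by blast
    then obtain q where q: "in_S q" "p = l * q" using in_S_dvdE[OF in_S_l homog_in_S[OF p(1)]] by blast
    show ?thesis
    proof (cases "q = 0")
      case False
      with homog_cofactor[OF homog_l l_nonzero q(1), of n] p(1) q(2)
      have "1 \<le> n \<and> homog (n - 1) q" by blast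
      with q show ?thesis by auto
    qed (use q in auto)
  qed
  from v(2) assms(3-5) *[of "fst v"] *[of "fst (snd v)"] *[of "snd (snd v)"]
  obtain a b c where abc: "fst v = l * a" "fst (snd v) = l * b" "snd (snd v) = l * c"
    "homog (n - 1) a" "homog (n - 1) b" "homog (n - 1) c" "n = 0 \<longrightarrow> a = 0 \<and> b = 0 \<and> c = 0"
    unfolding homog_triple_iff by metis
  have eq: "v = smul l (a, b, c)" by (rule triple_eqI) (simp_all add: abc smul_def)
  have h: "homog_triple (n - 1) (a, b, c)" using abc by (simp add: homog_triple_iff)
  have "l * act (a, b, c) f = 0" using v(1) eq by (simp add: D0_iff_act act_smul)
  then have "(a, b, c) \<in> D0 f" using l_nonzero homog_triple_in_S3[OF h] by (simp add: D0_iff_act)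
  with that[OF _ h eq] abc show thesis by (auto simp: zero_prod_def)
qed

text \<open>A syzygy w of minimal degree outside N generates D0 f modulo N: the coordinates of l w with
respect to t1, t2 restrict to coprime forms on the line, by minimality.\<close>

context
  fixes w :: triple and e :: nat and a b :: mpoly
  assumes w: "w \<in> D0 f" "w \<notin> N" "homog_triple e w"
    and w_min: "\<And>u n. u \<in> D0 f \<Longrightarrow> homog_triple n u \<Longrightarrow> n < e \<Longrightarrow> u \<in> N"
    and ab: "shom e1 (Suc e) a" "shom e2 (Suc e) b" "smul l w = smul a t1 + smul b t2"
begin

lemma ab_in_S: "in_S a" "in_S b"
  using ab by (auto dest: shom_in_S)

text \<open>The combination V = A t1 + B t2 of the cofactors satisfies g V = l w modulo l N, so V
  vanishes on the line and V = l u. The degree n - 1 of u is below e as m > 0, so u lies in N by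
  minimality, and then so does w.\<close>

lemma no_common_factor:
  assumes g: "homog m g" "T g \<noteq> 0" "m + n = Suc e" "m > 0"
    and A: "shom e1 n A" "T a = T g * T A" and B: "shom e2 n B" "T b = T g * T B"
  shows False
proof -
  have "\<exists>p. in_S p \<and> a - g * A = l * p" "\<exists>q. in_S q \<and> b - g * B = l * q"
    using ab shom_mult[OF g(1) A(1)] shom_mult[OF g(1) B(1)] A B
    by (auto intro!: shom_dvd[OF shom_diff] simp: g(3) T.ev_diff T.ev_mult)
  then obtain p q where pq: "in_S p" "in_S q" "a - g * A = l * p" "b - g * B = l * q" by blast
  define V where "V = smul A t1 + smul B t2"
  have V: "V \<in> N" "homog_triple n V"
    unfolding V_def using A(1) B(1) homog_t
    by (auto intro!: N_lin_comb homog_triple_add shom_smul dest: shom_in_S)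
  have aa: "a = g * A + l * p" and bb: "b = g * B + l * q" using pq by (simp_all add: algebra_simps)
  have "smul g V = smul a t1 + smul b t2 - smul l (smul p t1 + smul q t2)"
    unfolding aa bb by (rule triple_eqI) (simp_all add: V_def smul_def algebra_simps)
  then have gV: "smul g V = smul l (w - (smul p t1 + smul q t2))"
    by (simp only: ab(3)[symmetric] smul_diff_right)
  have cancel: "T y = 0" if "g * y = l * x" for x y
    using arg_cong[OF that, of T] g(2) by (simp add: T.ev_mult)
  have "T (fst V) = 0" "T (fst (snd V)) = 0" "T (snd (snd V)) = 0"
    using gV unfolding smul_def prod_eq_iff fst_conv snd_conv by (blast intro: cancel)+
  moreover have "V \<in> D0 f" using V by (simp add: N_def)
  ultimately obtain u where u: "u \<in> D0 f" "homog_triple (n - 1) u" "V = smul l u" "n = 0 \<Longrightarrow> u = 0"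
    using divide_by_l V by blast
  have uN: "u \<in> N"
  proof (cases "n = 0")
    case True
    then show ?thesis using u by (simp add: N_def act_def)
  next
    case False
    then show ?thesis using w_min[OF u(1,2)] g by simp
  qed
  have "smul l (smul g u) = smul l (w - (smul p t1 + smul q t2))"
    using gV by (simp add: u(3) smul_smul mult.commute)
  then have "smul g u = w - (smul p t1 + smul q t2)" using smul_cancel[OF l_nonzero] by blast
  then have "w = smul g u + (smul p t1 + smul q t2)" by simp
  moreover have "smul g u + (smul p t1 + smul q t2) \<in> N"
    using uN pq homog_in_S[OF g(1)] by (intro N_add N_smul N_lin_comb) auto
  ultimately show False using w(2) by simp
qed

text \<open>The inequality \<open>degree g \<le> m\<close> lets a common zero at x_k = 0, invisible
  in the chart, count as a common factor.\<close>

lemma no_common_factor':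
  assumes "degree g \<le> m" "g \<noteq> 0" "m + n = Suc e" "m > 0"
    and "bounded e1 n \<alpha>" "T a = g * \<alpha>" "bounded e2 n \<beta>" "T b = g * \<beta>"
  shows False
proof -
  obtain A where "shom e1 n A" "T A = \<alpha>" using bounded_lift[OF assms(5)] .
  moreover obtain B where "shom e2 n B" "T B = \<beta>" using bounded_lift[OF assms(7)] .
  ultimately show False
    using no_common_factor[OF homog_lift[of m g] _ assms(3,4), of A B] assms by (simp add: T_lift)
qed

text \<open>Otherwise x_k would be a common factor on the line; in the chart this is g = 1 with m =
  1.\<close>

lemma full_degree: "T a \<noteq> 0 \<and> e1 + degree (T a) = Suc e \<or> T b \<noteq> 0 \<and> e2 + degree (T b) = Suc e"
proof (rule ccontr)
  assume "\<not> ?thesis"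
  then have "bounded e1 e (T a)" "bounded e2 e (T b)"
    using bounded_T[OF ab(1)] bounded_T[OF ab(2)] by (auto simp: bounded_def)
  then show False using no_common_factor'[of 1 1 e "T a" "T b"] by simp
qed

text \<open>This excludes common zeros at the affine points of the line; \<open>full_degree\<close>
  deals with the point x_k = 0.\<close>

lemma coprime_ab: "coprime (T a) (T b)"
proof -
  define g where "g = gcd (T a) (T b)"
  have g0: "g \<noteq> 0" using full_degree by (auto simp: g_def)
  obtain \<alpha> \<beta> where \<alpha>: "T a = g * \<alpha>" and \<beta>: "T b = g * \<beta>"
    unfolding g_def by (metis gcd_dvd1 gcd_dvd2 dvdE)
  have le: "degree g \<le> Suc e"
    using full_degree \<alpha> \<beta> g0 by (auto simp: degree_mult_eq)
  have bd: "bounded e' (Suc e - degree g) \<gamma>" if "bounded e' (Suc e) (g * \<gamma>)" for e' \<gamma>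
    using that g0 by (cases "\<gamma> = 0") (auto simp: bounded_def degree_mult_eq)
  have "degree g = 0"
  proof (rule ccontr)
    assume "degree g \<noteq> 0"
    then show False
      using no_common_factor'[of g "degree g" "Suc e - degree g" \<alpha> \<beta>] le g0 \<alpha> \<beta>
        bd[of e1 \<alpha>] bd[of e2 \<beta>] bounded_T[OF ab(1)] bounded_T[OF ab(2)] by simp
  qed
  with g0 have "is_unit g" by (simp add: is_unit_iff_degree)
  then show ?thesis by (simp add: g_def coprime_iff_gcd_eq_1)
qed

text \<open>By rank one the coordinates of l m on the line are proportional to those of l w, and
  coprimality makes the ratio a polynomial. Subtracting a lift R of the ratio times w leaves
  coordinates divisible by l, and l cancels.\<close>

lemma generated_homog:
  assumes m: "m \<in> D0 f" "homog_triple n m"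
  shows "\<exists>r. in_S r \<and> m - smul r w \<in> N"
proof (cases "n < e")
  case True
  then show ?thesis using w_min[OF m] by (intro exI[of _ 0]) simp
next
  case False
  have "homog_triple (1 + n) (smul l m)" using homog_triple_smul[OF homog_l m(2)] .
  moreover obtain p q where "in_S p" "in_S q" "smul l m = smul p t1 + smul q t2"
    using N_gen[OF smul_l_N[OF m(1)]] by blast
  ultimately obtain a' b' where a'b': "shom e1 (Suc n) a'" "shom e2 (Suc n) b'"
    "smul l m = smul a' t1 + smul b' t2"
    using gen_homog[OF _ _ _ homog_t] by (metis plus_1_eq_Suc)
  have eq: "T a * T b' = T a' * T b" using rank_one[OF ab(3) a'b'(3)] .
  have "\<exists>\<rho>. T a' = \<rho> * T a \<and> T b' = \<rho> * T b"
  proof (cases "T a = 0")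
    case True
    with coprime_ab have u: "is_unit (T b)" by simp
    then obtain \<rho> where "T b' = \<rho> * T b" by (metis unit_imp_dvd dvdE mult.commute)
    moreover have "T a' = 0" using eq True u by auto
    ultimately show ?thesis using True by auto
  next
    case False
    have "T a dvd T a' * T b" using eq by (metis dvd_triv_left)
    then have "T a dvd T a'" using coprime_ab by (simp add: coprime_dvd_mult_left_iff)
    then obtain \<rho> where \<rho>: "T a' = \<rho> * T a" by (metis dvdE mult.commute)
    with eq have "T a * T b' = T a * (\<rho> * T b)" by (simp add: mult_ac)
    with False \<rho> show ?thesis by auto
  qed
  then obtain \<rho> where \<rho>: "T a' = \<rho> * T a" "T b' = \<rho> * T b" by blast
  \<comment> \<open>One of \<open>T a\<close>, \<open>T b\<close> attains its maximal degree, so the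
    bound on its multiple limits the ratio, which therefore lifts to a form of degree n - e.\<close>
  have "degree \<rho> \<le> n - e"
    using full_degree bounded_T[OF a'b'(1)] bounded_T[OF a'b'(2)] \<rho> False
    by (cases "\<rho> = 0") (auto simp: bounded_def degree_mult_eq)
  define R where "R = lift (n - e) \<rho>"
  have R: "homog (n - e) R" "T R = \<rho>" using \<open>degree \<rho> \<le> n - e\<close> by (simp_all add: R_def T_lift)
  have "shom e1 (Suc n) (R * a)" "shom e2 (Suc n) (R * b)"
    using shom_mult[OF R(1) ab(1)] shom_mult[OF R(1) ab(2)] False by simp_all
  then have "\<exists>p. in_S p \<and> a' - R * a = l * p" "\<exists>q. in_S q \<and> b' - R * b = l * q"
    using a'b' \<rho> R by (auto intro!: shom_dvd[OF shom_diff] simp: T.ev_diff T.ev_mult)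
  then obtain p q where pq: "in_S p" "in_S q" "a' - R * a = l * p" "b' - R * b = l * q" by blast
  have "smul l (m - smul R w) = smul l m - smul R (smul l w)"
    by (simp add: smul_diff_right smul_smul mult.commute)
  also have "\<dots> = smul (a' - R * a) t1 + smul (b' - R * b) t2"
    unfolding ab(3) a'b'(3) by (rule triple_eqI) (simp_all add: smul_def algebra_simps)
  also have "\<dots> = smul l (smul p t1 + smul q t2)"
    unfolding pq by (simp add: smul_add_right smul_smul)
  finally have "m - smul R w = smul p t1 + smul q t2" using smul_cancel[OF l_nonzero] by blast
  then have "m - smul R w \<in> N" using N_lin_comb pq by simp
  then show ?thesis using homog_in_S[OF R(1)] by blast
qed

lemma generated:
  assumes "v \<in> D0 f"
  obtains r p q where "in_S r" "in_S p" "in_S q" "v = smul r w + smul p t1 + smul q t2"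
proof -
  obtain n where n: "(\<Sum>k\<le>n. hc3 k v) = v" by (rule sum_hc3)
  have "\<exists>r. in_S r \<and> hc3 k v - smul r w \<in> N" for k
    using assms by (intro generated_homog[of _ k] D0_hc3[OF f] homog_triple_hc3) (auto simp: D0_iff_act)
  then obtain r where r: "in_S (r k)" "hc3 k v - smul (r k) w \<in> N" for k by metis
  have "(\<Sum>k\<le>n. hc3 k v - smul (r k) w) \<in> N" using r by (intro N_sum) auto
  then have "v - smul (\<Sum>k\<le>n. r k) w \<in> N" by (simp add: sum_subtractf n smul_sum_left)
  then obtain p q where pq: "in_S p" "in_S q" "v - smul (\<Sum>k\<le>n. r k) w = smul p t1 + smul q t2"
    using N_gen by blast
  have "v = smul (\<Sum>k\<le>n. r k) w + smul p t1 + smul q t2"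
    using pq(3) by (simp only: diff_eq_eq) (simp only: ac_simps)
  moreover have "in_S (\<Sum>k\<le>n. r k)" using r by simp
  ultimately show thesis using that[of "\<Sum>k\<le>n. r k" p q] pq(1,2) by simp
qed

lemma D0_w_t: "w \<in> D0 f" "t1 \<in> D0 f" "t2 \<in> D0 f"
  using w t by (auto simp: N_def)

text \<open>The relation l w = z t1 + b t2 can be solved for t1, leaving w and t2 as
  generators.\<close>

lemma redundant_t1:
  assumes "a = const z" "z \<noteq> 0"
  shows "free_curve f"
proof (rule free_curve_if_two_generators[OF f f_nonzero D0_w_t(1,3) w(3) homog_t(2)])
  fix v assume "v \<in> D0 f"
  then obtain r p q where v: "in_S r" "in_S p" "in_S q" "v = smul r w + smul p t1 + smul q t2"
    by (rule generated)
  have "const (1 / z) * const z = 1" using assms by (simp flip: const_mult)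
  then have "t1 = smul (const (1 / z)) (smul a t1)"
    by (simp add: smul_smul assms)
  also have "smul a t1 = smul l w - smul b t2" using ab(3) by simp
  finally have "smul p t1 = smul p (smul (const (1 / z)) (smul l w - smul b t2))" by (rule arg_cong)
  then have "v = smul r w + smul p (smul (const (1 / z)) (smul l w - smul b t2)) + smul q t2"
    using v(4) by simp
  also have "\<dots> = smul (r + p * const (1 / z) * l) w + smul (q - p * const (1 / z) * b) t2"
    by (rule triple_eqI) (simp_all add: smul_def algebra_simps)
  finally show "\<exists>p q. in_S p \<and> in_S q \<and> v = smul p w + smul q t2"
    using v(1-3) ab_in_S by (intro exI[of _ "r + p * const (1 / z) * l"] exI[of _ "q - p * const (1 / z) * b"]) simp
qed

text \<open>If w had smaller degree than t1, then t1 or t2 would be redundant.\<close>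

lemma free_if_degree_less:
  assumes "e < e1" "\<And>z. z \<noteq> 0 \<Longrightarrow> b = const z \<Longrightarrow> free_curve f"
  shows "free_curve f"
proof (cases "a = 0")
  case True
  \<comment> \<open>\<open>T b\<close> is a nonzero constant, so \<open>full_degree\<close> yields
    e2 = e + 1 and b itself has degree zero.\<close>
  then have "is_unit (T b)" using coprime_ab by simp
  then have "degree (T b) = 0" by (metis is_unit_iff_degree not_is_unit_0)
  moreover have "T b \<noteq> 0 \<and> e2 + degree (T b) = Suc e" using full_degree True by simp
  moreover have "b \<noteq> 0" using calculation by auto
  ultimately have "homog 0 b" "b \<noteq> 0" using ab(2) by (auto simp: shom_def)
  then show ?thesis using assms(2) by (metis homog_0_const const_0)
next
  case False
  \<comment> \<open>A nonzero a needs e1 \<le> e + 1, so e < e1 leaves it degree zero.\<close>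
  with ab(1) assms(1) have "homog 0 a" by (auto simp: shom_def)
  with False show ?thesis using redundant_t1 by (metis homog_0_const const_0)
qed

end

lemma dichotomy:
  obtains "free_curve f"
  | w e where "w \<in> D0 f" "homog_triple e w" "e1 \<le> e" "e2 \<le> e"
    "\<And>v. v \<in> D0 f \<Longrightarrow> \<exists>p q r. in_S p \<and> in_S q \<and> in_S r \<and> v = smul p t1 + smul q t2 + smul r w"
proof (cases "D0 f \<subseteq> N")
  case True
  have "free_curve f"
  proof (rule free_curve_if_two_generators[OF f f_nonzero _ _ homog_t])
    show "t1 \<in> D0 f" "t2 \<in> D0 f" using t by (auto simp: N_def)
    show "\<exists>p q. in_S p \<and> in_S q \<and> v = smul p t1 + smul q t2" if "v \<in> D0 f" for v
      using True that by (intro N_gen) blast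
  qed
  then show thesis by (rule that)
next
  case False
  then obtain v where v: "v \<in> D0 f" "v \<notin> N" by blast
  obtain n where n: "(\<Sum>k\<le>n. hc3 k v) = v" by (rule sum_hc3)
  have ex: "\<exists>e w. w \<in> D0 f \<and> w \<notin> N \<and> homog_triple e w"
  proof (rule ccontr)
    assume "\<not> ?thesis"
    moreover have "hc3 k v \<in> D0 f" "homog_triple k (hc3 k v)" for k
      using v(1) D0_hc3[OF f] homog_triple_hc3 by (auto simp: D0_iff_act)
    ultimately have "hc3 k v \<in> N" for k by blast
    then have "(\<Sum>k\<le>n. hc3 k v) \<in> N" by (intro N_sum)
    with n v show False by simp
  qed
  define e where "e = (LEAST e. \<exists>w. w \<in> D0 f \<and> w \<notin> N \<and> homog_triple e w)"
  obtain w where w: "w \<in> D0 f" "w \<notin> N" "homog_triple e w"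
    using LeastI_ex[OF ex] unfolding e_def by blast
  have w_min: "u \<in> N" if "u \<in> D0 f" "homog_triple n u" "n < e" for u n
    using not_less_Least[of n "\<lambda>e. \<exists>w. w \<in> D0 f \<and> w \<notin> N \<and> homog_triple e w"] that
    unfolding e_def by blast
  obtain p q where "in_S p" "in_S q" "smul l w = smul p t1 + smul q t2"
    using N_gen[OF smul_l_N[OF w(1)]] by blast
  moreover have "homog_triple (Suc e) (smul l w)" using homog_triple_smul[OF homog_l w(3)] by simp
  ultimately obtain a b where ab: "shom e1 (Suc e) a" "shom e2 (Suc e) b"
    "smul l w = smul a t1 + smul b t2"
    using gen_homog[OF _ _ _ homog_t] by metis
  have ba: "smul l w = smul b t2 + smul a t1" using ab(3) by (simp add: add.commute)
  \<comment> \<open>Exchanging t1 and t2 gives the redundancy of t2, which supplies the hypothesis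
    on b in \<open>free_if_degree_less\<close>, and covers the case e < e2.\<close>
  interpret swap: free_addition l i j k zi zj zk f d t2 t1 e2 e1
  proof unfold_locales
    fix v assume "v \<in> N"
    from N_gen[OF this] show "\<exists>p q. in_S p \<and> in_S q \<and> v = smul p t2 + smul q t1"
      by (metis add.commute)
  qed (use t homog_t in auto)
  note red1 = redundant_t1[OF w w_min ab] and red2 = swap.redundant_t1[OF w w_min ab(2,1) ba]
  show thesis
  proof (cases "e1 \<le> e \<and> e2 \<le> e")
    case True
    have "\<exists>p q r. in_S p \<and> in_S q \<and> in_S r \<and> v = smul p t1 + smul q t2 + smul r w" if v: "v \<in> D0 f" for v
    proof -
      obtain r p q where "in_S r" "in_S p" "in_S q" "v = smul r w + smul p t1 + smul q t2"
        using generated[OF w w_min ab v] .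
      then show ?thesis by (intro exI[of _ p] exI[of _ q] exI[of _ r]) (simp add: ac_simps)
    qed
    with that(2)[OF w(1,3)] True show thesis by blast
  next
    case False
    then have "free_curve f"
      using free_if_degree_less[OF w w_min ab _ red2] swap.free_if_degree_less[OF w w_min ab(2,1) ba _ red1]
      by fastforce
    then show thesis by (rule that(1))
  qed
qed

end

text \<open>The three generators need not be minimal: if some system has at most two elements, it
  has exactly two and the curve is free; otherwise three is the minimum.\<close>

lemma plus_one_generated_if_three_generators:
  assumes f: "homog (Suc d) f" "f \<noteq> 0"
    and g: "g1 \<in> D0 f" "g2 \<in> D0 f" "g3 \<in> D0 f"
    and hg: "homog_triple d1 g1" "homog_triple d2 g2" "homog_triple d3 g3"
    and le: "d1 \<le> d2" "d2 \<le> d3" and sum: "d1 + d2 = Suc d"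
    and gen: "\<And>v. v \<in> D0 f \<Longrightarrow> \<exists>p q r. in_S p \<and> in_S q \<and> in_S r \<and> v = smul p g1 + smul q g2 + smul r g3"
  shows "free_curve f \<or> plus_one_generated (Suc d) f"
proof (cases "\<exists>gs ds. hom_gen_system f gs ds \<and> length gs \<le> 2")
  case True
  then obtain gs ds where gs: "hom_gen_system f gs ds" "length gs = 2"
    using hom_gen_system_length_ge_2[OF f] by (metis le_antisym)
  then have "length ds = 2" by (simp add: hom_gen_system_def)
  with gs obtain g1 g2 d1 d2 where eq: "gs = [g1, g2]" "ds = [d1, d2]"
    by (auto simp: numeral_2_eq_2 length_Suc_conv)
  have "free_curve f"
  proof (rule free_curve_if_two_generators[OF f])
    show "g1 \<in> D0 f" "g2 \<in> D0 f" "homog_triple d1 g1" "homog_triple d2 g2"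
      using gs(1) unfolding eq hom_gen_system_def by (auto simp: All_less_Suc2)
    show "\<exists>p q. in_S p \<and> in_S q \<and> v = smul p g1 + smul q g2" if "v \<in> D0 f" for v
      using gs(1) that unfolding eq by (rule hom_gen_system_2_gen)
  qed
  then show ?thesis ..
next
  case False
  have "hom_gen_system f [g1, g2, g3] [d1, d2, d3]"
    unfolding hom_gen_system_def
  proof (intro conjI ballI)
    fix v assume "v \<in> D0 f"
    then obtain p q r where "in_S p" "in_S q" "in_S r" "v = smul p g1 + smul q g2 + smul r g3"
      using gen by blast
    then show "\<exists>hs. length hs = length [g1, g2, g3] \<and> (\<forall>h\<in>set hs. in_S h) \<and> v = lin_comb hs [g1, g2, g3]"
      by (intro exI[of _ "[p, q, r]"]) (simp add: lin_comb_eq)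
  qed (use g hg in \<open>auto simp: less_Suc_eq\<close>)
  with False have "min_hom_gen_system f [g1, g2, g3] [d1, d2, d3]"
    by (force simp: min_hom_gen_system_def)
  with le have "exponents f [d1, d2, d3]" by (auto simp: exponents_def)
  with sum have "plus_one_generated (Suc d) f"
    unfolding plus_one_generated_def by (intro exI[of _ "[d1, d2, d3]"]) simp
  then show ?thesis ..
qed

theorem theorem1p1:
  fixes f l :: mpoly and d :: nat
  assumes "homog d f" and "d \<ge> 3" and "reduced f"
    and "homog 1 l" and "l \<noteq> 0"
    and "\<not> l dvd f"
    and "free_curve (f * l)"
  shows "free_curve f \<or> plus_one_generated d f"
proof -
  obtain i j k zi zj zk where "line l i j k zi zj zk"
    using linear_form_line[OF assms(4,5)] .
  then interpret line l i j k zi zj zk .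
  obtain d' where d: "d = Suc d'" using assms(2) by (cases d) auto
  interpret deletion l i j k zi zj zk f d'
    by unfold_locales (use assms d in auto)
  have red: "reduced (f * l)" using reduced_mult_linear assms by blast
  have hom: "homog (Suc d) (f * l)" using homog_mult[OF assms(1,4)] by simp
  obtain gs ds where gs: "hom_gen_system (f * l) gs ds" "length ds = 2"
    using assms(7) by (auto simp: free_curve_def exponents_def min_hom_gen_system_def)
  then have "length gs = 2" by (simp add: hom_gen_system_def)
  with gs(2) obtain r1 r2 e1 e2 where eq: "gs = [r1, r2]" "ds = [e1, e2]"
    by (auto simp: numeral_2_eq_2 length_Suc_conv)
  have r: "r1 \<in> D0 (f * l)" "r2 \<in> D0 (f * l)" "homog_triple e1 r1" "homog_triple e2 r2"
    using gs(1) unfolding eq hom_gen_system_def by (auto simp: All_less_Suc2)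
  have gen: "\<exists>p q. in_S p \<and> in_S q \<and> v = smul p r1 + smul q r2" if "v \<in> D0 (f * l)" for v
    using gs(1) that unfolding eq by (rule hom_gen_system_2_gen)
  \<comment> \<open>The degree of f l is d + 1, so its exponents add up to d, the degree of
    f.\<close>
  have sum: "e1 + e2 = d"
    using free_degree_sum[OF red hom _ r(3,4) gen] assms(2) by simp
  obtain t1 q1 where t1: "t1 \<in> N" "homog_triple e1 t1" "in_S q1" "t1 = r1 + smul q1 eul"
    using D0_mult_to_N[OF r(1,3)] .
  obtain t2 q2 where t2: "t2 \<in> N" "homog_triple e2 t2" "in_S q2" "t2 = r2 + smul q2 eul"
    using D0_mult_to_N[OF r(2,4)] .
  have N_gen: "\<exists>p q. in_S p \<and> in_S q \<and> v = smul p t1 + smul q t2" if vN: "v \<in> N" for v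
  proof -
    obtain s where s: "in_S s" "v - smul s eul \<in> D0 (f * l)" using N_to_D0_mult[OF vN] .
    obtain p q where pq: "in_S p" "in_S q" "v - smul s eul = smul p r1 + smul q r2" using gen[OF s(2)] by blast
    \<comment> \<open>After the generators are rewritten through t1 and t2, a multiple of the Euler
      field remains. It must annihilate f because v, t1 and t2 do, so its coefficient is
      zero.\<close>
    have "v = smul p r1 + smul q r2 + smul s eul" using pq(3) by (metis diff_add_cancel)
    also have "\<dots> = smul p t1 + smul q t2 + smul (s - p * q1 - q * q2) eul"
      unfolding t1 t2 by (rule triple_eqI) (simp_all add: smul_def algebra_simps)
    finally have v: "v = smul p t1 + smul q t2 + smul (s - p * q1 - q * q2) eul" .
    have "act v f = 0" "act t1 f = 0" "act t2 f = 0" using vN t1(1) t2(1) by (simp_all add: N_def D0_iff_act)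
    then have "(s - p * q1 - q * q2) * act eul f = 0" by (simp add: v act_add act_smul)
    moreover have "act eul f \<noteq> 0" using act_eul[OF f] f_nonzero by (simp del: of_nat_Suc)
    ultimately have "s - p * q1 - q * q2 = 0" by simp
    with v have "v = smul p t1 + smul q t2" by (simp del: diff_diff_eq)
    with pq show ?thesis by blast
  qed
  interpret free_addition l i j k zi zj zk f d' t1 t2 e1 e2
    by unfold_locales (use t1 t2 N_gen in auto)
  note three = plus_one_generated_if_three_generators[OF f f_nonzero, folded d]
  have D0t: "t1 \<in> D0 f" "t2 \<in> D0 f" using t1 t2 by (simp_all add: N_def)
  show ?thesis
  proof (cases rule: dichotomy)
    case 1
    then show ?thesis ..
  next
    case (2 w e)
    show ?thesis
    proof (cases "e1 \<le> e2")
      case True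
      then show ?thesis by (intro three[OF D0t 2(1) t1(2) t2(2) 2(2) _ 2(4) sum 2(5)])
    next
      case False
      have "\<exists>p q r. in_S p \<and> in_S q \<and> in_S r \<and> v = smul p t2 + smul q t1 + smul r w" if "v \<in> D0 f" for v
        using 2(5)[OF that] by (metis add.commute)
      with False sum show ?thesis
        by (intro three[OF D0t(2,1) 2(1) t2(2) t1(2) 2(2) _ 2(3)]) auto
    qed
  qed
qed

end
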